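(* Let $p$ be a prime and $d,m,n$ positive integers, and let $R$ be a finite local ring of order $p^{dn}$ whose maximal ideal $I$ is generated by $\pi$, with $\pi^{n-1}\neq0$, $\pi^n=0$, $p=\pi^m u$ for a unit $u$, and $R/I$ a field of order $p^d$. Let $R_1\subseteq R$ be a set of coset representatives of $I$ in $R$ with $0\in R_1$, let $R_0=\{0\}$ and $R_i=R_1+\pi R_1+\cdots+\pi^{i-1}R_1$ for $1\le i\le n$. For $r\in R$ and $s\in I$ let $I_r=\{(x,xr):x\in R\}$ and $J_s=\{(xs,x):x\in R\}$, subgroups of $R\times R$. Let $h$ be a positive integer and let $\eta$, $\eta_r$ ($r\in R$), $\delta_u$ ($u\in R_{n-1}$), $\mu_s$ ($s\in I$), $\gamma_v$ ($v\in\pi R_{n-2}$) be complex $h$th roots of unity such that for all $1\le i\le n-1$ and $0\le j\le n-2$: $$\sum_{r\in u+I^i}\eta_r=\delta_u\ \text{ for all } u\in R_i,\qquad \sum_{s\in v+I^{j+1}}\mu_s=\gamma_v\ \text{ for all } v\in\pi R_j,$$ $$\sum_{u\in R_1}\delta_u+\sum_{v\in\pi R_1}\gamma_v=\eta.$$ Put $D=\sum_{r\in R}\eta_r I_r+\sum_{s\in I}\mu_s J_s\in\mathbb{Z}[\zeta_h][R\times R]$. Then every coefficient of $D$ is a complex $h$th root of unity and $DD^{(-1)}=|R\times R|$. Consequently a $\mathrm{BH}(R\times R,h)$ matrix exists.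
   Context: $I^j$ denotes the $j$th power of the ideal $I$. $\zeta_h$ is a primitive complex $h$th root of unity; $\mathbb{Z}[\zeta_h][G]$ is the group ring of the finite abelian group $G=R\times R$ (written multiplicatively in the group ring), a subset $S\subseteq G$ is identified with $\sum_{g\in S}g$, and an integer $\lambda$ with $\lambda\cdot 1_G$. For $X=\sum_g a_g g$, $X^{(-1)}=\sum_g\overline{a_g}\,g^{-1}$. A $\mathrm{BH}(G,h)$ matrix is a $|G|\times|G|$ matrix $H=(H_{g,k})_{g,k\in G}$ that is $G$-invariant ($H_{g+l,k+l}=H_{g,k}$ for all $g,k,l$), has all entries complex $h$th roots of unity, and satisfies $HH^*=|G|I_{|G|}$.
   Formalization: The closing equation uses values of γ_v (n = 2) and δ_u (n = 1) that are not given; for n = 2 its γ-sum is read as γ_0, and for n = 1 the equation is read as the sum of η_u over u in R_1 plus μ_0 equals η; for n ≥ 3 it is verbatim. *)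

theory Defs
  imports
    Complex_Main
    "HOL-Library.Indicator_Function"
    "HOL-Computational_Algebra.Polynomial"
    "HOL-Computational_Algebra.Primes"
    "HOL-Algebra.Ideal_Product"
    "HOL-Algebra.QuotRing"
begin

section \<open>Roots of unity\<close>

definition root_of_unity :: "nat \<Rightarrow> complex \<Rightarrow> bool" where
  "root_of_unity h z \<longleftrightarrow> z ^ h = 1"

definition primitive_root_of_unity :: "nat \<Rightarrow> complex \<Rightarrow> bool" where
  "primitive_root_of_unity h z \<longleftrightarrow>
     root_of_unity h z \<and> (\<forall>k. 0 < k \<and> k < h \<longrightarrow> \<not> root_of_unity k z)"

definition int_adjoin :: "complex \<Rightarrow> complex set" where
  "int_adjoin z = {poly (map_poly of_int q) z |q :: int poly. True}"

section \<open>Group rings with complex coefficients\<close>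

text \<open>
  An element \<open>\<Sum> a\<^sub>g g\<close> of the group ring \<open>A[G]\<close> of a finite group \<open>G\<close>, with
  \<open>A\<close> a subring of the complex numbers, is its coefficient function, extended by zero outside
  the carrier. A subset \<open>S\<close> of the group is thus \<open>indicator S\<close>.
\<close>

definition group_ring :: "complex set \<Rightarrow> ('g, 'b) monoid_scheme \<Rightarrow> ('g \<Rightarrow> complex) set" where
  "group_ring A G = {X. (\<forall>g\<in>carrier G. X g \<in> A) \<and> (\<forall>g. g \<notin> carrier G \<longrightarrow> X g = 0)}"

definition gr_const :: "('g, 'b) monoid_scheme \<Rightarrow> int \<Rightarrow> 'g \<Rightarrow> complex" where
  "gr_const G c = (\<lambda>g. if g = \<one>\<^bsub>G\<^esub> then of_int c else 0)"

definition gr_mult ::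
  "('g, 'b) monoid_scheme \<Rightarrow> ('g \<Rightarrow> complex) \<Rightarrow> ('g \<Rightarrow> complex) \<Rightarrow> 'g \<Rightarrow> complex" where
  "gr_mult G X Y = (\<lambda>g. \<Sum>(k, l) \<in> {(k, l) \<in> carrier G \<times> carrier G. k \<otimes>\<^bsub>G\<^esub> l = g}. X k * Y l)"

text \<open>\<open>gr_star G X\<close> is \<open>X\<^sup>(\<^sup>-\<^sup>1\<^sup>) = \<Sum> cnj a\<^sub>g g\<^sup>-\<^sup>1\<close>.\<close>

definition gr_star :: "('g, 'b) monoid_scheme \<Rightarrow> ('g \<Rightarrow> complex) \<Rightarrow> 'g \<Rightarrow> complex" where
  "gr_star G X = (\<lambda>g. if g \<in> carrier G then cnj (X (inv\<^bsub>G\<^esub> g)) else 0)"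

section \<open>Group-invariant Butson matrices\<close>

definition BH_matrix :: "('g, 'b) monoid_scheme \<Rightarrow> nat \<Rightarrow> ('g \<Rightarrow> 'g \<Rightarrow> complex) \<Rightarrow> bool" where
  "BH_matrix G h H \<longleftrightarrow>
     (\<forall>g\<in>carrier G. \<forall>k\<in>carrier G. \<forall>l\<in>carrier G.
        H (g \<otimes>\<^bsub>G\<^esub> l) (k \<otimes>\<^bsub>G\<^esub> l) = H g k) \<and>
     (\<forall>g\<in>carrier G. \<forall>k\<in>carrier G. root_of_unity h (H g k)) \<and>
     (\<forall>g\<in>carrier G. \<forall>k\<in>carrier G.
        (\<Sum>l\<in>carrier G. H g l * cnj (H k l)) = (if g = k then of_nat (order G) else 0))"

section \<open>Finite local rings\<close>

definition local_ring_with :: "('a, 'b) ring_scheme \<Rightarrow> 'a set \<Rightarrow> bool" where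
  "local_ring_with R I \<longleftrightarrow> cring R \<and> maximalideal I R \<and> (\<forall>J. maximalideal J R \<longrightarrow> J = I)"

abbreviation ideal_power :: "('a, 'b) ring_scheme \<Rightarrow> 'a set \<Rightarrow> nat \<Rightarrow> 'a set" where
  "ideal_power R I j \<equiv> I [^]\<^bsub>ideals_set R\<^esub> j"

definition coset_reps :: "('a, 'b) ring_scheme \<Rightarrow> 'a set \<Rightarrow> 'a set \<Rightarrow> bool" where
  "coset_reps R I T \<longleftrightarrow> T \<subseteq> carrier R \<and> (\<forall>C \<in> a_rcosets\<^bsub>R\<^esub> I. \<exists>!x. x \<in> T \<and> x \<in> C)"

text \<open>
  With \<open>T = R\<^sub>1\<close>, \<open>digit_sums R \<pi> T i\<close> is
  \<open>R\<^sub>i = R\<^sub>1 + \<pi> R\<^sub>1 + \<dots> + \<pi>\<^sup>i\<^sup>-\<^sup>1 R\<^sub>1\<close>. The operation \<open><#\<close> is here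
  multiplication of a set by a ring element.
\<close>

primrec digit_sums :: "('a, 'b) ring_scheme \<Rightarrow> 'a \<Rightarrow> 'a set \<Rightarrow> nat \<Rightarrow> 'a set" where
  "digit_sums R \<pi> T 0 = {\<zero>\<^bsub>R\<^esub>}"
| "digit_sums R \<pi> T (Suc i) = digit_sums R \<pi> T i <+>\<^bsub>R\<^esub> ((\<pi> [^]\<^bsub>R\<^esub> i) <#\<^bsub>R\<^esub> T)"

text \<open>The additive group of \<open>R \<times> R\<close>; its operation is written multiplicatively.\<close>

abbreviation add_square :: "('a, 'b) ring_scheme \<Rightarrow> ('a \<times> 'a) monoid" where
  "add_square R \<equiv> add_monoid R \<times>\<times> add_monoid R"

definition line_I :: "('a, 'b) ring_scheme \<Rightarrow> 'a \<Rightarrow> ('a \<times> 'a) set" where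
  "line_I R r = {(x, x \<otimes>\<^bsub>R\<^esub> r) |x. x \<in> carrier R}"

definition line_J :: "('a, 'b) ring_scheme \<Rightarrow> 'a \<Rightarrow> ('a \<times> 'a) set" where
  "line_J R s = {(x \<otimes>\<^bsub>R\<^esub> s, x) |x. x \<in> carrier R}"

end

theory Submission
  imports Defs "HOL-Algebra.Multiplicative_Group"
begin

text \<open>
  Fix an additive character of \<open>R\<close> that is nontrivial on the socle \<open>\<pi>\<^sup>n\<^sup>-\<^sup>1 R\<close>. It identifies
  \<open>R \<times> R\<close> with its dual group through the symplectic form \<open>(x, y), (a, b) \<mapsto> x b - y a\<close>, and
  every line \<open>I\<^sub>r\<close>, \<open>J\<^sub>s\<close> is its own annihilator. Hence \<open>D\<close> is, up to the factor
  \<open>|R|\<close>, its own Fourier transform, and Parseval gives \<open>D D\<^sup>(\<^sup>-\<^sup>1\<^sup>) = |R \<times> R|\<close> as soon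
  as all coefficients of \<open>D\<close> have modulus one. The coefficient at \<open>(x, y) \<noteq> 0\<close> is a sum of the
  \<open>\<eta>\<^sub>r\<close> or of the \<open>\<mu>\<^sub>s\<close> over the solutions of \<open>x r = y\<close> or \<open>y s = x\<close>; in a chain ring
  exactly one of these equations is solvable, its solutions form a coset of a power of \<open>I\<close>,
  and the hypotheses say precisely that such sums are roots of unity.
\<close>

section \<open>Characters of finite abelian groups\<close>

text \<open>A homomorphism from a subgroup \<open>H\<close> to the nonzero complex numbers. The
  domain \<open>H\<close> is part of the data because characters are built by enlarging it; values
  of \<open>\<chi>\<close> outside \<open>H\<close> are unconstrained.\<close>

definition partial_char :: "('g, 'b) monoid_scheme \<Rightarrow> 'g set \<Rightarrow> ('g \<Rightarrow> complex) \<Rightarrow> bool" where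
  "partial_char G H \<chi> \<longleftrightarrow> subgroup H G \<and> (\<forall>x\<in>H. \<chi> x \<noteq> 0) \<and> (\<forall>x\<in>H. \<forall>y\<in>H. \<chi> (x \<otimes>\<^bsub>G\<^esub> y) = \<chi> x * \<chi> y)"

lemma (in group) partial_char_one:
  assumes "partial_char G H \<chi>" shows "\<chi> \<one> = 1"
proof -
  have "\<one> \<in> H" using assms by (simp add: partial_char_def subgroup.one_closed)
  then have "\<chi> \<one> * \<chi> \<one> = \<chi> \<one>" "\<chi> \<one> \<noteq> 0" using assms unfolding partial_char_def by (metis l_one one_closed)+
  then show ?thesis by simp
qed

lemma (in group) subgroup_pow_closed:
  assumes "subgroup H G" "x \<in> H" shows "x [^] (i::nat) \<in> H"
  using assms by (induct i) (auto simp: subgroup.one_closed subgroup.m_closed)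

lemma (in group) partial_char_pow:
  assumes "partial_char G H \<chi>" "x \<in> H" shows "\<chi> (x [^] (i::nat)) = \<chi> x ^ i"
proof (induct i)
  case 0 then show ?case using partial_char_one[OF assms(1)] by simp
next
  case (Suc i)
  have "x [^] i \<in> H" using assms subgroup_pow_closed by (auto simp: partial_char_def)
  then show ?case using assms Suc by (simp add: partial_char_def)
qed

lemma (in group) subgroup_cancel_left:
  assumes "subgroup H G" "x \<in> H" "y \<in> carrier G" "x \<otimes> y \<in> H" shows "y \<in> H"
proof -
  have "y = inv x \<otimes> (x \<otimes> y)"
    using assms(3) subgroup.mem_carrier[OF assms(1,2)] by (simp flip: m_assoc)
  then show ?thesis
    using subgroup.m_closed[OF assms(1) subgroup.m_inv_closed[OF assms(1,2)] assms(4)] by simp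
qed

text \<open>Division with remainder puts the power of \<open>a\<close> with exponent
  \<open>t mod k\<close> into \<open>H\<close>, and minimality of \<open>k\<close> forces this
  remainder to be 0.\<close>

lemma (in group) least_power_dvd:
  assumes H: "subgroup H G" and a: "a \<in> carrier G" and k: "a [^] (k::nat) \<in> H"
    and least: "\<And>j. 0 < j \<Longrightarrow> j < k \<Longrightarrow> a [^] j \<notin> H"
    and "0 < k" and t: "a [^] (t::nat) \<in> H"
  shows "k dvd t"
proof -
  have "a [^] t = (a [^] k) [^] (t div k) \<otimes> a [^] (t mod k)"
    by (simp add: nat_pow_pow nat_pow_mult a)
  then have "a [^] (t mod k) \<in> H"
    using subgroup_cancel_left[OF H] subgroup_pow_closed[OF H k] t a by (metis nat_pow_closed)
  then show ?thesis using least[of "t mod k"] \<open>0 < k\<close> by fastforce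
qed

text \<open>Setting \<open>\<chi>' (g \<otimes> a [^] i) = \<chi> g * w ^ i\<close> extends the
  character to the subgroup generated by \<open>H\<close> and \<open>a\<close>. Two representations
  of one element differ by a power of \<open>a [^] k\<close>, so the condition on \<open>w\<close>
  gives consistency. The free choice of the root \<open>w\<close> is what later separates an element
  from the identity.\<close>

lemma (in comm_group) partial_char_extend:
  assumes fin: "finite (carrier G)" and \<chi>: "partial_char G H \<chi>" and a: "a \<in> carrier G"
    and k: "a [^] (k::nat) \<in> H" and "0 < k"
    and least: "\<And>j. 0 < j \<Longrightarrow> j < k \<Longrightarrow> a [^] j \<notin> H"
    and w: "w ^ k = \<chi> (a [^] k)"
  obtains H' \<chi>' where "partial_char G H' \<chi>'" "H \<subseteq> H'" "a \<in> H'" "\<And>x. x \<in> H \<Longrightarrow> \<chi>' x = \<chi> x" "\<chi>' a = w"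
proof -
  have H: "subgroup H G" and mult: "\<And>x y. x \<in> H \<Longrightarrow> y \<in> H \<Longrightarrow> \<chi> (x \<otimes> y) = \<chi> x * \<chi> y"
    and nz: "\<And>x. x \<in> H \<Longrightarrow> \<chi> x \<noteq> 0"
    using \<chi> by (auto simp: partial_char_def)
  note Hc = subgroup.mem_carrier[OF H] and one = subgroup.one_closed[OF H] and mcl = subgroup.m_closed[OF H]
  have w0: "w \<noteq> 0" using w nz[OF k] \<open>0 < k\<close> by (metis power_0_left less_numeral_extra(3))
  \<comment> \<open>Exponents are natural numbers, so the comparison is made first for
    \<open>i \<le> j\<close>; the general case follows by symmetry.\<close>
  have wd: "\<chi> g * w ^ i = \<chi> g' * w ^ j"
    if "g \<in> H" "g' \<in> H" "g \<otimes> a [^] i = g' \<otimes> a [^] j" "i \<le> j" for g g' and i j :: nat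
  proof -
    have "g \<otimes> a [^] i = (g' \<otimes> a [^] (j - i)) \<otimes> a [^] i"
      using that a Hc by (simp add: m_assoc nat_pow_mult)
    then have g: "g = g' \<otimes> a [^] (j - i)" using that a Hc by (metis m_closed nat_pow_closed right_cancel)
    then have aH: "a [^] (j - i) \<in> H" using subgroup_cancel_left[OF H] that a by (metis nat_pow_closed)
    then obtain q where q: "j - i = k * q"
      using least_power_dvd[OF H a k least \<open>0 < k\<close>] by (metis dvdE)
    have "\<chi> (a [^] (j - i)) = w ^ (j - i)"
      using partial_char_pow[OF \<chi> k, of q] by (simp add: q w[symmetric] nat_pow_pow a power_mult)
    then have "\<chi> g * w ^ i = \<chi> g' * (w ^ (j - i) * w ^ i)" using g mult that aH by simp
    also have "w ^ (j - i) * w ^ i = w ^ j" using \<open>i \<le> j\<close> by (simp flip: power_add)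
    finally show ?thesis .
  qed
  have wd: "\<chi> g * w ^ i = \<chi> g' * w ^ j"
    if "g \<in> H" "g' \<in> H" "g \<otimes> a [^] i = g' \<otimes> a [^] j" for g g' and i j :: nat
    using wd[of g g' i j] wd[of g' g j i] that by (cases "i \<le> j") auto
  define H' where "H' = {g \<otimes> a [^] (i::nat) | g i. g \<in> H}"
  define \<chi>' where "\<chi>' z = (THE v. \<exists>g\<in>H. \<exists>i::nat. z = g \<otimes> a [^] i \<and> v = \<chi> g * w ^ i)" for z
  have val: "\<chi>' (g \<otimes> a [^] i) = \<chi> g * w ^ i" if "g \<in> H" for g and i :: nat
    unfolding \<chi>'_def
  proof (rule the_equality)
    show "\<exists>g'\<in>H. \<exists>j::nat. g \<otimes> a [^] i = g' \<otimes> a [^] j \<and> \<chi> g * w ^ i = \<chi> g' * w ^ j"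
      using that by blast
  next
    fix v assume "\<exists>g'\<in>H. \<exists>j::nat. g \<otimes> a [^] i = g' \<otimes> a [^] j \<and> v = \<chi> g' * w ^ j"
    then show "v = \<chi> g * w ^ i" using wd[OF that] by auto
  qed
  have prod: "(g \<otimes> a [^] i) \<otimes> (g' \<otimes> a [^] j) = (g \<otimes> g') \<otimes> a [^] (i + j)"
    if "g \<in> H" "g' \<in> H" for g g' and i j :: nat
    using that a Hc by (simp add: m_assoc m_lcomm flip: nat_pow_mult)
  have "H \<subseteq> H'"
  proof
    fix x assume "x \<in> H"
    then have "x = x \<otimes> a [^] (0::nat)" using Hc by simp
    with \<open>x \<in> H\<close> show "x \<in> H'" unfolding H'_def by blast
  qed
  have "a = \<one> \<otimes> a [^] (1::nat)" using a by simp
  then have "a \<in> H'" using one unfolding H'_def by blast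
  \<comment> \<open>Only nonnegative exponents occur in \<open>H'\<close>; it is closed under
    inverses because \<open>a [^] order G\<close> is the identity.\<close>
  have inv_pow: "inv (a [^] i) = a [^] ((order G - 1) * i)" for i :: nat
  proof (rule inv_equality)
    have "(order G - 1) * i + i = order G * i"
      using fin a order_gt_0_iff_finite by (cases "order G") auto
    then show "a [^] ((order G - 1) * i) \<otimes> a [^] i = \<one>"
      using a pow_order_eq_1[OF a] nat_pow_pow[OF a, of "order G" i] by (simp add: nat_pow_mult)
  qed (use a in auto)
  have sub: "subgroup H' G"
  proof (rule subgroupI)
    show "H' \<subseteq> carrier G" using a Hc by (auto simp: H'_def)
    show "H' \<noteq> {}" using \<open>a \<in> H'\<close> by auto
    show "inv x \<in> H'" if x: "x \<in> H'" for x
    proof -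
      obtain g and i :: nat where g: "g \<in> H" "x = g \<otimes> a [^] i" using x unfolding H'_def by blast
      then have "inv x = inv g \<otimes> a [^] ((order G - 1) * i)"
        using a Hc by (simp add: inv_mult inv_pow)
      then show ?thesis using subgroup.m_inv_closed[OF H] g unfolding H'_def by blast
    qed
    show "x \<otimes> y \<in> H'" if xy: "x \<in> H'" "y \<in> H'" for x y
      using xy prod mcl unfolding H'_def by blast
  qed
  have "partial_char G H' \<chi>'"
    unfolding partial_char_def
  proof (intro conjI ballI sub)
    show "\<chi>' x \<noteq> 0" if "x \<in> H'" for x using that nz w0 by (auto simp: H'_def val)
    show "\<chi>' (x \<otimes> y) = \<chi>' x * \<chi>' y" if "x \<in> H'" "y \<in> H'" for x y
      using that by (auto simp: H'_def prod val mcl mult power_add)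
  qed
  moreover have "\<chi>' x = \<chi> x" if "x \<in> H" for x
    using val[OF that, of 0] Hc[OF that] by simp
  moreover have "\<chi>' a = w"
    using val[OF one, of 1] a partial_char_one[OF \<chi>] by simp
  ultimately show thesis using that \<open>H \<subseteq> H'\<close> \<open>a \<in> H'\<close> by blast
qed

lemma (in group) ex_least_power_in_subgroup:
  assumes "finite (carrier G)" "subgroup H G" "a \<in> carrier G"
  obtains k :: nat where "0 < k" "a [^] k \<in> H" "\<And>j. 0 < j \<Longrightarrow> j < k \<Longrightarrow> a [^] j \<notin> H"
proof -
  define P where "P k \<longleftrightarrow> 0 < k \<and> a [^] k \<in> H" for k :: nat
  have "P (order G)"
    using assms pow_order_eq_1[OF assms(3)] order_gt_0_iff_finite subgroup.one_closed[OF assms(2)]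
    by (simp add: P_def)
  then have "P (Least P)" by (rule LeastI)
  moreover have "\<not> P j" if "j < Least P" for j using that by (rule not_less_Least)
  ultimately show thesis by (intro that[of "Least P"]) (auto simp: P_def)
qed

text \<open>Induction on the number of elements outside \<open>H\<close>: a missing element
  \<open>a\<close> is adjoined with any complex \<open>k\<close>th root of
  \<open>\<chi> (a [^] k)\<close> as its value.\<close>

lemma (in comm_group) partial_char_extend_carrier:
  assumes fin: "finite (carrier G)" and "partial_char G H \<chi>"
  obtains \<chi>' where "partial_char G (carrier G) \<chi>'" "\<And>x. x \<in> H \<Longrightarrow> \<chi>' x = \<chi> x"
proof -
  have "\<exists>\<chi>'. partial_char G (carrier G) \<chi>' \<and> (\<forall>x\<in>H. \<chi>' x = \<chi> x)"
    using assms(2)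
  proof (induct "card (carrier G - H)" arbitrary: H \<chi> rule: less_induct)
    case (less H \<chi>)
    have H: "subgroup H G" using less.prems by (simp add: partial_char_def)
    show ?case
    proof (cases "H = carrier G")
      case True then show ?thesis using less.prems by blast
    next
      case False
      then obtain a where a: "a \<in> carrier G" "a \<notin> H" using subgroup.subset[OF H] by blast
      obtain k :: nat where k: "0 < k" "a [^] k \<in> H" "\<And>j. 0 < j \<Longrightarrow> j < k \<Longrightarrow> a [^] j \<notin> H"
        using ex_least_power_in_subgroup[OF fin H a(1)] by blast
      have "card {z. z ^ k = \<chi> (a [^] k)} = k"
        using k less.prems by (intro card_nth_roots) (auto simp: partial_char_def)
      then obtain w where w: "w ^ k = \<chi> (a [^] k)" using \<open>0 < k\<close>
        by (metis (mono_tags, lifting) card.empty empty_Collect_eq less_irrefl)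
      obtain H' \<chi>' where H': "partial_char G H' \<chi>'" "H \<subseteq> H'" "a \<in> H'" "\<And>x. x \<in> H \<Longrightarrow> \<chi>' x = \<chi> x"
        using partial_char_extend[OF fin less.prems a(1) k(2,1,3) w] by metis
      have "carrier G - H' \<subset> carrier G - H" using H' a by blast
      then have "card (carrier G - H') < card (carrier G - H)" using fin by (intro psubset_card_mono) auto
      then obtain \<psi> where "partial_char G (carrier G) \<psi>" "\<forall>x\<in>H'. \<psi> x = \<chi>' x"
        using less.hyps H'(1) by blast
      then show ?thesis using H' by (metis subsetD)
    qed
  qed
  then show thesis using that by blast
qed

text \<open>The trivial character of the trivial subgroup is extended to \<open>a\<close> with a
  \<open>k\<close>th root of unity other than 1 as value, where \<open>k > 1\<close> is the order of
  \<open>a\<close>, and then to the whole group. All values have modulus one since their power with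
  exponent \<open>order G\<close> is 1.\<close>

lemma (in comm_group) ex_character_separating:
  assumes fin: "finite (carrier G)" and a: "a \<in> carrier G" "a \<noteq> \<one>"
  obtains \<chi> :: "'a \<Rightarrow> complex"
  where "\<And>x y. x \<in> carrier G \<Longrightarrow> y \<in> carrier G \<Longrightarrow> \<chi> (x \<otimes> y) = \<chi> x * \<chi> y"
    and "\<And>x. x \<in> carrier G \<Longrightarrow> norm (\<chi> x) = 1" and "\<chi> a \<noteq> 1"
proof -
  have triv: "partial_char G {\<one>} (\<lambda>_. 1)" by (simp add: partial_char_def triv_subgroup)
  obtain k :: nat where k: "0 < k" "a [^] k \<in> {\<one>}" "\<And>j. 0 < j \<Longrightarrow> j < k \<Longrightarrow> a [^] j \<notin> {\<one>}"
    using ex_least_power_in_subgroup[OF fin triv_subgroup a(1)] by blast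
  have "k \<noteq> 1" using k(2) a by auto
  have "\<not> {z::complex. z ^ k = 1} \<subseteq> {1}"
    using card_mono[of "{1}" "{z::complex. z ^ k = 1}"] card_roots_unity_eq[OF \<open>0 < k\<close>] \<open>0 < k\<close> \<open>k \<noteq> 1\<close> by auto
  then obtain w :: complex where w: "w ^ k = 1" "w \<noteq> 1" by blast
  obtain H \<chi> where H: "partial_char G H \<chi>" "a \<in> H" "\<chi> a = w"
    using partial_char_extend[OF fin triv a(1) k(2,1,3) w(1)] by metis
  obtain \<psi> where \<psi>: "partial_char G (carrier G) \<psi>" "\<And>x. x \<in> H \<Longrightarrow> \<psi> x = \<chi> x"
    using partial_char_extend_carrier[OF fin H(1)] by blast
  have "norm (\<psi> x) = 1" if "x \<in> carrier G" for x
  proof -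
    have "\<psi> x ^ order G = 1"
      using partial_char_pow[OF \<psi>(1) that, of "order G"] that partial_char_one[OF \<psi>(1)] by (simp add: pow_order_eq_1)
    then show ?thesis
      using power_eq_1_iff[of "\<psi> x" "order G"] fin order_gt_0_iff_finite by simp
  qed
  then show thesis using that[of \<psi>] \<psi> H w(2) by (auto simp: partial_char_def)
qed

section \<open>Autocorrelation, group rings and Butson matrices\<close>

text \<open>A pair \<open>(k, l)\<close> with product \<open>g\<close> is determined by
  \<open>inv l\<close>; this substitution turns the coefficient at \<open>g\<close> into the
  autocorrelation of \<open>D\<close> at \<open>g\<close>.\<close>

lemma (in comm_group) gr_mult_star_eq:
  assumes ac: "\<And>g. g \<in> carrier G \<Longrightarrow>
      (\<Sum>k\<in>carrier G. D (g \<otimes> k) * cnj (D k)) = (if g = \<one> then of_nat (order G) else 0)"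
  shows "gr_mult G D (gr_star G D) = gr_const G (int (order G))"
proof
  fix g
  show "gr_mult G D (gr_star G D) g = gr_const G (int (order G)) g"
  proof (cases "g \<in> carrier G")
    case False
    then have "{(k, l) \<in> carrier G \<times> carrier G. k \<otimes> l = g} = {}" "g \<noteq> \<one>" by auto
    then show ?thesis by (simp only: gr_mult_def gr_const_def) simp
  next
    case True
    have "gr_mult G D (gr_star G D) g = (\<Sum>k\<in>carrier G. D (g \<otimes> k) * cnj (D k))"
      unfolding gr_mult_def
    proof (rule sum.reindex_bij_witness[where i = "\<lambda>k. (g \<otimes> k, inv k)" and j = "\<lambda>(k, l). inv l"], goal_cases)
      case (1 x) then show ?case by (auto simp: m_assoc)
    next
      case (2 x) then show ?case by auto
    next
      case (3 x) then show ?case by auto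
    next
      case (4 x) then show ?case using True by (auto simp: m_assoc)
    next
      case (5 x) then show ?case by (auto simp: gr_star_def m_assoc)
    qed
    then show ?thesis using ac[OF True] by (simp add: gr_const_def)
  qed
qed

text \<open>An entry depends only on the quotient of its indices, which gives invariance. The
  substitution \<open>x = k \<otimes> inv l\<close> turns the inner product of the rows
  \<open>g\<close> and \<open>k\<close> into the autocorrelation at
  \<open>g \<otimes> inv k\<close>.\<close>

lemma (in comm_group) BH_matrix_of_autocorrelation:
  assumes ru: "\<And>g. g \<in> carrier G \<Longrightarrow> root_of_unity h (D g)"
    and ac: "\<And>g. g \<in> carrier G \<Longrightarrow>
      (\<Sum>k\<in>carrier G. D (g \<otimes> k) * cnj (D k)) = (if g = \<one> then of_nat (order G) else 0)"
  shows "BH_matrix G h (\<lambda>g k. D (g \<otimes> inv k))"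
  unfolding BH_matrix_def
proof (intro conjI ballI)
  fix g k l assume gkl: "g \<in> carrier G" "k \<in> carrier G" "l \<in> carrier G"
  have "(g \<otimes> l) \<otimes> inv (k \<otimes> l) = g \<otimes> inv k"
    using gkl by (simp add: inv_mult_group m_assoc) (simp flip: m_assoc)
  then show "D (g \<otimes> l \<otimes> inv (k \<otimes> l)) = D (g \<otimes> inv k)" by simp
next
  fix g k assume gk: "g \<in> carrier G" "k \<in> carrier G"
  show "root_of_unity h (D (g \<otimes> inv k))" using ru gk by simp
  have "(\<Sum>l\<in>carrier G. D (g \<otimes> inv l) * cnj (D (k \<otimes> inv l)))
      = (\<Sum>x\<in>carrier G. D ((g \<otimes> inv k) \<otimes> x) * cnj (D x))"
  proof (rule sum.reindex_bij_witness[where i = "\<lambda>x. k \<otimes> inv x" and j = "\<lambda>l. k \<otimes> inv l"], goal_cases)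
    case (1 l) then show ?case using gk by (simp add: inv_mult m_assoc[symmetric])
  next
    case (2 l) then show ?case using gk by simp
  next
    case (3 x) then show ?case using gk by (simp add: inv_mult m_assoc[symmetric])
  next
    case (4 x) then show ?case using gk by simp
  next
    case (5 l)
    then have "(g \<otimes> inv k) \<otimes> (k \<otimes> inv l) = g \<otimes> inv l"
      using gk by (simp add: m_assoc) (simp flip: m_assoc)
    then show ?case by simp
  qed
  moreover have "g \<otimes> inv k = \<one> \<longleftrightarrow> g = k" using gk by (metis inv_equality inv_inv inv_closed r_inv)
  ultimately show "(\<Sum>l\<in>carrier G. D (g \<otimes> inv l) * cnj (D (k \<otimes> inv l))) = (if g = k then of_nat (order G) else 0)"
    using ac[of "g \<otimes> inv k"] gk by simp
qed

text \<open>The first \<open>h\<close> powers of a primitive root are distinct, hence they exhaust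
  the \<open>h\<close> roots of unity; so \<open>z\<close> is the value of a monomial at
  \<open>\<zeta>\<close>.\<close>

lemma int_adjoin_of_root_of_unity:
  assumes "h > 0" "primitive_root_of_unity h \<zeta>" "root_of_unity h z"
  shows "z \<in> int_adjoin \<zeta>"
proof -
  have z1: "\<zeta> ^ h = 1" and min: "\<And>k. 0 < k \<Longrightarrow> k < h \<Longrightarrow> \<zeta> ^ k \<noteq> 1"
    using assms(2) by (auto simp: primitive_root_of_unity_def root_of_unity_def)
  have "\<zeta> \<noteq> 0" using z1 assms(1) by (metis power_0_left not_gr_zero zero_neq_one)
  have "inj_on (\<lambda>k. \<zeta> ^ k) {..<h}"
  proof (rule linorder_inj_onI)
    fix i j assume "i < j" "i \<in> {..<h}" "j \<in> {..<h}"
    then have "\<zeta> ^ (j - i) \<noteq> 1" by (intro min) auto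
    moreover have "\<zeta> ^ j = \<zeta> ^ (j - i) * \<zeta> ^ i" using \<open>i < j\<close> by (simp flip: power_add)
    ultimately show "\<zeta> ^ i \<noteq> \<zeta> ^ j" using \<open>\<zeta> \<noteq> 0\<close> by auto
  qed auto
  then have card: "card ((\<lambda>k. \<zeta> ^ k) ` {..<h}) = h" by (simp add: card_image)
  have "(\<lambda>k. \<zeta> ^ k) ` {..<h} \<subseteq> {z. z ^ h = 1}"
    using z1 by (auto simp: power_mult[symmetric] mult.commute[of _ h]) (simp add: power_mult)
  then have "(\<lambda>k. \<zeta> ^ k) ` {..<h} = {z. z ^ h = 1}"
    using assms(1) card card_roots_unity_eq by (intro card_subset_eq) auto
  then obtain k where k: "z = \<zeta> ^ k" using assms(3) by (auto simp: root_of_unity_def)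
  have "z = poly (map_poly of_int (Polynomial.monom (1::int) k)) \<zeta>"
    by (simp add: k Polynomial.map_poly_monom Polynomial.poly_monom)
  then show ?thesis unfolding int_adjoin_def by blast
qed

section \<open>Fourier transform of line sums over a finite commutative ring\<close>

text \<open>The coefficient function of the element \<open>D\<close> of the theorem, with the second
  family of lines indexed by an arbitrary set, so that its Fourier transform can be computed over
  any finite commutative ring with a generating character.\<close>

definition line_sum :: "('a, 'b) ring_scheme \<Rightarrow> 'a set \<Rightarrow> ('a \<Rightarrow> complex) \<Rightarrow> ('a \<Rightarrow> complex) \<Rightarrow> 'a \<times> 'a \<Rightarrow> complex" where
  "line_sum R I \<eta> \<mu> g =
     (\<Sum>r\<in>carrier R. \<eta> r * indicator (line_I R r) g) + (\<Sum>s\<in>I. \<mu> s * indicator (line_J R s) g)"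

lemma (in cring) line_sum_eq:
  assumes "finite (carrier R)" "I \<subseteq> carrier R" "x \<in> carrier R" "y \<in> carrier R"
  shows "line_sum R I \<eta> \<mu> (x, y) =
    sum \<eta> {r \<in> carrier R. x \<otimes> r = y} + sum \<mu> {s \<in> I. y \<otimes> s = x}"
proof -
  have fI: "finite I" using assms finite_subset by blast
  have "(\<Sum>r\<in>carrier R. \<eta> r * indicator (line_I R r) (x, y)) = (\<Sum>r\<in>carrier R. if x \<otimes> r = y then \<eta> r else 0)"
    using assms by (intro sum.cong) (auto simp: line_I_def indicator_def)
  moreover have "(\<Sum>s\<in>I. \<mu> s * indicator (line_J R s) (x, y)) = (\<Sum>s\<in>I. if y \<otimes> s = x then \<mu> s else 0)"
    using assms by (intro sum.cong) (auto simp: line_J_def indicator_def)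
  ultimately show ?thesis
    using assms(1) fI by (simp add: line_sum_def sum.If_cases Collect_conj_eq Int_commute)
qed

text \<open>The last axiom says that the kernel of \<open>\<psi>\<close> contains no nonzero ideal.
  Equivalently, the maps sending \<open>x\<close> to \<open>\<psi> (x \<otimes> z)\<close> are
  pairwise distinct for distinct \<open>z\<close>, and so are all the additive characters of the
  ring.\<close>

locale generating_character = cring R for R (structure) +
  fixes \<psi> :: "'a \<Rightarrow> complex"
  assumes fin: "finite (carrier R)"
    and add: "\<And>x y. x \<in> carrier R \<Longrightarrow> y \<in> carrier R \<Longrightarrow> \<psi> (x \<oplus> y) = \<psi> x * \<psi> y"
    and norm: "\<And>x. x \<in> carrier R \<Longrightarrow> norm (\<psi> x) = 1"
    and generating: "\<And>z. z \<in> carrier R \<Longrightarrow> z \<noteq> \<zero> \<Longrightarrow> \<exists>x\<in>carrier R. \<psi> (x \<otimes> z) \<noteq> 1"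
begin

section \<open>Orthogonality relations for the additive character\<close>

lemma character_cnj: "x \<in> carrier R \<Longrightarrow> \<psi> x * cnj (\<psi> x) = 1"
  using norm[of x] by (simp add: complex_norm_square[symmetric])

lemma character_zero: "\<psi> \<zero> = 1"
  using add[of \<zero> \<zero>] norm[of \<zero>] by auto

lemma character_minus: "x \<in> carrier R \<Longrightarrow> \<psi> (\<ominus> x) = cnj (\<psi> x)"
  using add[of x "\<ominus> x"] character_cnj[of x] norm[of x]
  by (metis a_inv_closed character_zero mult_cancel_left norm_zero r_neg zero_neq_one)

text \<open>For nonzero \<open>z\<close>, translating the summation variable by some
  \<open>t\<close> with \<open>\<psi> (t \<otimes> z) \<noteq> 1\<close> multiplies the sum by that
  value, so the sum vanishes.\<close>

lemma sum_character:
  assumes z: "z \<in> carrier R"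
  shows "(\<Sum>x\<in>carrier R. \<psi> (x \<otimes> z)) = (if z = \<zero> then of_nat (order R) else 0)"
proof (cases "z = \<zero>")
  case True then show ?thesis by (simp add: character_zero order_def)
next
  case False
  then obtain t where t: "t \<in> carrier R" "\<psi> (t \<otimes> z) \<noteq> 1" using generating z by blast
  have "(\<Sum>x\<in>carrier R. \<psi> (x \<otimes> z)) = (\<Sum>x\<in>carrier R. \<psi> ((t \<oplus> x) \<otimes> z))"
    by (rule sum.reindex_bij_witness[where i = "\<lambda>x. t \<oplus> x" and j = "\<lambda>x. \<ominus> t \<oplus> x"])
       (use t in \<open>auto simp: r_neg1 r_neg2\<close>)
  also have "\<dots> = \<psi> (t \<otimes> z) * (\<Sum>x\<in>carrier R. \<psi> (x \<otimes> z))"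
    using t z by (simp add: l_distr add sum_distrib_left)
  finally show ?thesis using t False by auto
qed

lemma character_orthogonal:
  assumes "b \<in> carrier R" "c \<in> carrier R"
  shows "(\<Sum>x\<in>carrier R. \<psi> (x \<otimes> b) * cnj (\<psi> (x \<otimes> c))) = (if b = c then of_nat (order R) else 0)"
proof -
  have "\<psi> (x \<otimes> b) * cnj (\<psi> (x \<otimes> c)) = \<psi> (x \<otimes> (b \<ominus> c))" if "x \<in> carrier R" for x
    using that assms by (simp add: minus_eq r_distr add r_minus character_minus)
  then show ?thesis using sum_character[of "b \<ominus> c"] assms by simp
qed

text \<open>Conjugating a value of \<open>\<psi>\<close> negates its argument, so this is
  \<open>\<psi>\<close> applied to the symplectic form \<open>x b - y a\<close> of
  \<open>(x, y)\<close> and \<open>(a, b)\<close>. The form vanishes on any two points of the same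
  line.\<close>

definition pairing :: "'a \<times> 'a \<Rightarrow> 'a \<times> 'a \<Rightarrow> complex" where
  "pairing k a = \<psi> (fst k \<otimes> snd a) * cnj (\<psi> (snd k \<otimes> fst a))"

lemma sum_pairing:
  assumes "a \<in> carrier R \<times> carrier R" "b \<in> carrier R \<times> carrier R"
  shows "(\<Sum>k\<in>carrier R \<times> carrier R. pairing k a * cnj (pairing k b))
    = (if a = b then of_nat (order R) ^ 2 else 0)"
proof -
  have "(\<Sum>k\<in>carrier R \<times> carrier R. pairing k a * cnj (pairing k b))
    = (\<Sum>x\<in>carrier R. \<Sum>y\<in>carrier R. (\<psi> (x \<otimes> snd a) * cnj (\<psi> (x \<otimes> snd b))) *
        (\<psi> (y \<otimes> fst b) * cnj (\<psi> (y \<otimes> fst a))))"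
    unfolding sum.cartesian_product by (intro sum.cong) (auto simp: pairing_def)
  also have "\<dots> = (\<Sum>x\<in>carrier R. \<psi> (x \<otimes> snd a) * cnj (\<psi> (x \<otimes> snd b))) *
      (\<Sum>y\<in>carrier R. \<psi> (y \<otimes> fst b) * cnj (\<psi> (y \<otimes> fst a)))"
    by (simp add: sum_product)
  also have "\<dots> = (if a = b then of_nat (order R) ^ 2 else 0)"
    using assms by (auto simp: character_orthogonal prod_eq_iff mem_Times_iff power2_eq_square)
  finally show ?thesis .
qed

text \<open>Each line is its own annihilator under the pairing, so \<open>line_sum\<close> is an eigenfunction of
  the associated Fourier transform.\<close>

lemma fourier_line_sum:
  assumes I: "I \<subseteq> carrier R" and k: "k \<in> carrier R \<times> carrier R"
  shows "(\<Sum>a\<in>carrier R \<times> carrier R. line_sum R I \<eta> \<mu> a * pairing k a)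
    = of_nat (order R) * line_sum R I \<eta> \<mu> k"
proof -
  obtain x y where k: "k = (x, y)" "x \<in> carrier R" "y \<in> carrier R" using k by auto
  let ?C = "carrier R \<times> carrier R" and ?q = "of_nat (order R) :: complex"
  have fC: "finite ?C" using fin by simp
  have I': "s \<in> carrier R" if "s \<in> I" for s using that I by blast
  have on_I: "(\<Sum>a\<in>?C. indicator (line_I R r) a * pairing k a) = ?q * indicator (line_I R r) k"
    if r: "r \<in> carrier R" for r
  proof -
    have "(\<Sum>a\<in>?C. indicator (line_I R r) a * pairing k a) = (\<Sum>a\<in>line_I R r. pairing k a)"
      using fC r by (intro sum.mono_neutral_cong_right) (auto simp: line_I_def)
    also have "\<dots> = (\<Sum>b\<in>carrier R. pairing k (b, b \<otimes> r))"
      by (rule sum.reindex_bij_witness[where i = "\<lambda>b. (b, b \<otimes> r)" and j = fst]) (auto simp: line_I_def)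
    \<comment> \<open>Orthogonality makes this sum vanish unless \<open>x \<otimes> r = y\<close>,
      that is, unless \<open>k\<close> lies on the line itself.\<close>
    also have "\<dots> = (\<Sum>b\<in>carrier R. \<psi> (b \<otimes> (x \<otimes> r)) * cnj (\<psi> (b \<otimes> y)))"
      using k r by (intro sum.cong) (simp_all add: pairing_def m_lcomm m_comm[of y])
    also have "\<dots> = ?q * indicator (line_I R r) k"
      using k r by (subst character_orthogonal) (auto simp: line_I_def indicator_def)
    finally show ?thesis .
  qed
  have on_J: "(\<Sum>a\<in>?C. indicator (line_J R s) a * pairing k a) = ?q * indicator (line_J R s) k"
    if s: "s \<in> carrier R" for s
  proof -
    have "(\<Sum>a\<in>?C. indicator (line_J R s) a * pairing k a) = (\<Sum>a\<in>line_J R s. pairing k a)"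
      using fC s by (intro sum.mono_neutral_cong_right) (auto simp: line_J_def)
    also have "\<dots> = (\<Sum>b\<in>carrier R. pairing k (b \<otimes> s, b))"
      by (rule sum.reindex_bij_witness[where i = "\<lambda>b. (b \<otimes> s, b)" and j = snd]) (auto simp: line_J_def)
    also have "\<dots> = (\<Sum>b\<in>carrier R. \<psi> (b \<otimes> x) * cnj (\<psi> (b \<otimes> (y \<otimes> s))))"
      using k s by (intro sum.cong) (simp_all add: pairing_def m_lcomm m_comm[of x])
    also have "\<dots> = ?q * indicator (line_J R s) k"
      using k s by (subst character_orthogonal) (auto simp: line_J_def indicator_def)
    finally show ?thesis .
  qed
  have "(\<Sum>a\<in>?C. line_sum R I \<eta> \<mu> a * pairing k a)
    = (\<Sum>r\<in>carrier R. \<eta> r * (\<Sum>a\<in>?C. indicator (line_I R r) a * pairing k a))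
      + (\<Sum>s\<in>I. \<mu> s * (\<Sum>a\<in>?C. indicator (line_J R s) a * pairing k a))"
    by (simp add: line_sum_def distrib_right sum.distrib sum_distrib_right sum_distrib_left
        sum.swap[of _ ?C] mult.assoc)
  then show ?thesis
    by (simp add: on_I on_J I' line_sum_def distrib_left sum_distrib_left mult.left_commute)
qed

text \<open>Parseval with a shift: both factors are replaced by their transforms, orthogonality
  leaves only the terms with \<open>a = b\<close>, and there \<open>D a * cnj (D a) = 1\<close>.
  What remains is the sum of a character over all of \<open>R \<times> R\<close>.\<close>

lemma line_sum_autocorrelation:
  fixes \<eta> \<mu> :: "'a \<Rightarrow> complex" and I :: "'a set"
  defines "D \<equiv> line_sum R I \<eta> \<mu>"
  assumes I: "I \<subseteq> carrier R"
    and norm_D: "\<And>k. k \<in> carrier R \<times> carrier R \<Longrightarrow> norm (D k) = 1"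
    and xy: "x \<in> carrier R" "y \<in> carrier R"
  shows "(\<Sum>k\<in>carrier R \<times> carrier R. D (x \<oplus> fst k, y \<oplus> snd k) * cnj (D k))
    = (if (x, y) = (\<zero>, \<zero>) then of_nat (order R) ^ 2 else 0)"
proof -
  let ?C = "carrier R \<times> carrier R" and ?q = "of_nat (order R) :: complex"
  have fC: "finite ?C" using fin by simp
  have q0: "?q \<noteq> 0" using fin by (auto simp: order_def)
  have D: "?q * D k = (\<Sum>a\<in>?C. D a * pairing k a)" if "k \<in> ?C" for k
    using fourier_line_sum[OF I that] by (simp add: D_def)
  have pair_add: "pairing (x \<oplus> fst k, y \<oplus> snd k) a = pairing (x, y) a * pairing k a"
    if "k \<in> ?C" "a \<in> ?C" for k a
    using that xy by (auto simp: pairing_def l_distr add)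
  \<comment> \<open>One factor \<open>?q\<close> goes to each copy of \<open>D\<close>, since
    \<open>?q * D\<close> is the transform of \<open>D\<close>.\<close>
  have "?q\<^sup>2 * (\<Sum>k\<in>?C. D (x \<oplus> fst k, y \<oplus> snd k) * cnj (D k))
    = (\<Sum>k\<in>?C. (?q * D (x \<oplus> fst k, y \<oplus> snd k)) * cnj (?q * D k))"
    by (simp add: sum_distrib_left power2_eq_square mult_ac)
  also have "\<dots> = (\<Sum>k\<in>?C. (\<Sum>a\<in>?C. D a * (pairing (x, y) a * pairing k a))
      * (\<Sum>b\<in>?C. cnj (D b) * cnj (pairing k b)))"
  proof (rule sum.cong[OF refl])
    fix k assume k: "k \<in> ?C"
    then have "(x \<oplus> fst k, y \<oplus> snd k) \<in> ?C" using xy by auto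
    from D[OF this] D[OF k] show "(?q * D (x \<oplus> fst k, y \<oplus> snd k)) * cnj (?q * D k)
      = (\<Sum>a\<in>?C. D a * (pairing (x, y) a * pairing k a)) * (\<Sum>b\<in>?C. cnj (D b) * cnj (pairing k b))"
      using pair_add[OF k] by simp
  qed
  also have "\<dots> = (\<Sum>k\<in>?C. \<Sum>a\<in>?C. \<Sum>b\<in>?C. D a * pairing (x, y) a * cnj (D b) * (pairing k a * cnj (pairing k b)))"
    unfolding sum_product by (intro sum.cong refl) (simp add: mult_ac)
  also have "\<dots> = (\<Sum>a\<in>?C. \<Sum>b\<in>?C. \<Sum>k\<in>?C. D a * pairing (x, y) a * cnj (D b) * (pairing k a * cnj (pairing k b)))"
    by (subst sum.swap, rule sum.cong[OF refl], rule sum.swap)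
  also have "\<dots> = (\<Sum>a\<in>?C. \<Sum>b\<in>?C. D a * pairing (x, y) a * cnj (D b) * (if a = b then ?q\<^sup>2 else 0))"
    by (intro sum.cong refl) (simp only: sum_pairing flip: sum_distrib_left)
  also have "\<dots> = (\<Sum>a\<in>?C. \<Sum>b\<in>?C. if a = b then D a * pairing (x, y) a * cnj (D b) * ?q\<^sup>2 else 0)"
    by (intro sum.cong refl) auto
  also have "\<dots> = (\<Sum>a\<in>?C. D a * pairing (x, y) a * cnj (D a) * ?q\<^sup>2)"
    using fC by (simp add: sum.delta)
  also have "\<dots> = ?q\<^sup>2 * (\<Sum>a\<in>?C. pairing (x, y) a)"
  proof -
    have "D a * pairing (x, y) a * cnj (D a) * ?q\<^sup>2 = ?q\<^sup>2 * pairing (x, y) a" if "a \<in> ?C" for a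
    proof -
      have "D a * cnj (D a) = 1" using norm_D[OF that] by (simp add: complex_norm_square[symmetric])
      then show ?thesis by (metis mult.assoc mult.commute mult.right_neutral)
    qed
    then show ?thesis by (simp only: sum_distrib_left cong: sum.cong)
  qed
  also have "(\<Sum>a\<in>?C. pairing (x, y) a) = (if (x, y) = (\<zero>, \<zero>) then ?q\<^sup>2 else 0)"
  proof -
    have "(\<Sum>a\<in>?C. pairing (x, y) a)
      = (\<Sum>b\<in>carrier R. \<Sum>a\<in>carrier R. \<psi> (a \<otimes> x) * cnj (\<psi> (b \<otimes> y)))"
      unfolding sum.cartesian_product
      using xy by (intro sum.cong) (auto simp: pairing_def m_comm)
    \<comment> \<open>The factors with argument \<zero> equal 1; they give both sums the form of
      \<open>character_orthogonal\<close>.\<close>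
    also have "\<dots> = (\<Sum>b\<in>carrier R. \<psi> (b \<otimes> \<zero>) * cnj (\<psi> (b \<otimes> y))) * (\<Sum>a\<in>carrier R. \<psi> (a \<otimes> x) * cnj (\<psi> (a \<otimes> \<zero>)))"
      unfolding sum_product by (intro sum.cong refl) (simp add: character_zero)
    also have "\<dots> = (if (x, y) = (\<zero>, \<zero>) then ?q\<^sup>2 else 0)"
      using xy by (subst (1 2) character_orthogonal) (auto simp: power2_eq_square)
    finally show ?thesis .
  qed
  finally show ?thesis using q0 by simp
qed

end

section \<open>Finite chain rings\<close>

lemma (in ring) mem_l_coset_iff:
  assumes "J \<subseteq> carrier R" "u \<in> carrier R" "x \<in> carrier R"
  shows "x \<in> u <+ J \<longleftrightarrow> x \<ominus> u \<in> J"
proof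
  assume "x \<in> u <+ J"
  then obtain j where j: "j \<in> J" "x = u \<oplus> j" by (auto simp: a_l_coset_def')
  then have "x \<ominus> u = j" using assms by (auto simp: minus_eq a_ac r_neg r_neg1)
  then show "x \<ominus> u \<in> J" using j by simp
next
  assume "x \<ominus> u \<in> J"
  moreover have "x = u \<oplus> (x \<ominus> u)" using assms by (simp add: minus_eq a_lcomm[of u] r_neg)
  ultimately show "x \<in> u <+ J" by (auto simp: a_l_coset_def')
qed

lemma (in ring) l_coset_eqI:
  assumes "ideal J R" "u \<in> carrier R" "x \<in> u <+ J"
  shows "x <+ J = u <+ J"
  using a_l_repr_independence[of x u J] assms additive_subgroup.a_subgroup ideal.axioms(1) by blast

lemma (in ring) coset_reps_cover:
  assumes J: "ideal J R" and T: "coset_reps R J T" and x: "x \<in> carrier R"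
  obtains t where "t \<in> T" "x \<in> t <+ J"
proof -
  interpret J: ideal J R by fact
  have "J +> x \<in> a_rcosets J" using x J.a_subset by (simp add: a_rcosetsI)
  then obtain t where t: "t \<in> T" "t \<in> J +> x" using T by (auto simp: coset_reps_def)
  then have "t \<in> carrier R" using T by (auto simp: coset_reps_def)
  have "t \<ominus> x \<in> J" using J.a_rcos_module_minus[OF ring_axioms x \<open>t \<in> carrier R\<close>] t by simp
  \<comment> \<open>\<open>coset_reps\<close> places \<open>t\<close> in the coset of
    \<open>x\<close>; the sums need \<open>x\<close> in the coset of \<open>t\<close>, hence the
    opposite difference.\<close>
  then have "\<ominus> (t \<ominus> x) \<in> J" by simp
  then have "x \<ominus> t \<in> J" using x \<open>t \<in> carrier R\<close> by (simp add: minus_eq minus_add a_comm)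
  then show thesis using that t x \<open>t \<in> carrier R\<close> J.a_subset by (simp add: mem_l_coset_iff)
qed

lemma (in ring) coset_reps_unique:
  assumes J: "ideal J R" and T: "coset_reps R J T" and t: "t \<in> T" "t' \<in> T" "t \<ominus> t' \<in> J"
  shows "t = t'"
proof -
  interpret J: ideal J R by fact
  have c: "t \<in> carrier R" "t' \<in> carrier R" using T t by (auto simp: coset_reps_def)
  have "t \<in> J +> t'" using J.a_rcos_module_minus[OF ring_axioms c(2,1)] t by simp
  moreover have "t' \<in> J +> t'" using J.a_rcos_self c by simp
  moreover have "J +> t' \<in> a_rcosets J" using c J.a_subset by (simp add: a_rcosetsI)
  ultimately show ?thesis using T t unfolding coset_reps_def by metis
qed

text \<open>The cosets of the representatives partition the ring.\<close>

lemma (in ring) sum_coset_reps: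
  fixes f :: "'a \<Rightarrow> complex"
  assumes fin: "finite (carrier R)" and J: "ideal J R" and T: "coset_reps R J T"
  shows "(\<Sum>t\<in>T. \<Sum>r\<in>t <+ J. f r) = (\<Sum>r\<in>carrier R. f r)"
proof -
  interpret J: ideal J R by fact
  have Tc: "T \<subseteq> carrier R" using T by (simp add: coset_reps_def)
  have sub: "t <+ J \<subseteq> carrier R" if "t \<in> T" for t
    using that Tc J.a_subset by (auto simp: a_l_coset_def')
  have "carrier R = (\<Union>t\<in>T. t <+ J)" using sub coset_reps_cover[OF J T] by blast
  moreover have "(\<Sum>r\<in>(\<Union>t\<in>T. t <+ J). f r) = (\<Sum>t\<in>T. \<Sum>r\<in>t <+ J. f r)"
  proof (rule sum.UNION_disjoint)
    show "finite T" using fin Tc finite_subset by blast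
    show "\<forall>t\<in>T. finite (t <+ J)" using sub fin finite_subset by blast
    show "\<forall>t\<in>T. \<forall>t'\<in>T. t \<noteq> t' \<longrightarrow> (t <+ J) \<inter> (t' <+ J) = {}"
    proof (intro ballI impI equals0I)
      fix t t' x assume *: "t \<in> T" "t' \<in> T" "t \<noteq> t'" "x \<in> (t <+ J) \<inter> (t' <+ J)"
      then have "t <+ J = t' <+ J" using l_coset_eqI[OF J] Tc by blast
      moreover have "t \<in> t <+ J" using * Tc J.a_subset by (subst mem_l_coset_iff) (auto simp: minus_eq r_neg)
      ultimately have "t \<ominus> t' \<in> J" using * Tc J.a_subset by (subst mem_l_coset_iff[symmetric]) auto
      then show False using coset_reps_unique[OF J T] * by blast
    qed
  qed
  ultimately show ?thesis by simp
qed

text \<open>A product of principal ideals is generated by the product of the generators. This turns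
  powers in the monoid of ideals into principal ideals, where membership is plain divisibility;
  exponent 0 gives the whole ring.\<close>

lemma (in cring) ideal_power_principal:
  assumes "a \<in> carrier R"
  shows "ideal_power R (Idl {a}) i = PIdl (a [^] i)"
proof (induct i)
  case 0
  have "PIdl \<one> = carrier R" by (force simp: cgenideal_def)
  then show ?case by (simp add: ideals_set_def)
next
  case (Suc i)
  have "ideal_power R (Idl {a}) (Suc i) = ideal_prod R (PIdl (a [^] i)) (PIdl a)"
    using Suc assms by (simp add: cgenideal_eq_genideal) (simp add: ideals_set_def)
  also have "\<dots> = Idl (PIdl (a [^] i \<otimes> a))"
    using assms by (simp add: ideal_prod_eq_genideal cgenideal_ideal cgenideal_prod)
  also have "\<dots> = PIdl (a [^] i \<otimes> a)"
  proof
    have "ideal (PIdl (a [^] i \<otimes> a)) R" using assms by (simp add: cgenideal_ideal)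
    then show "Idl (PIdl (a [^] i \<otimes> a)) \<subseteq> PIdl (a [^] i \<otimes> a)" by (simp add: genideal_minimal)
    show "PIdl (a [^] i \<otimes> a) \<subseteq> Idl (PIdl (a [^] i \<otimes> a))"
      using assms by (intro genideal_self) (auto simp: cgenideal_def)
  qed
  finally show ?case by simp
qed

lemma (in cring) PIdl_pow_antimono:
  assumes "a \<in> carrier R" "i \<le> (j::nat)"
  shows "PIdl (a [^] j) \<subseteq> PIdl (a [^] i)"
proof -
  have "a [^] j = a [^] (j - i) \<otimes> a [^] i" using assms by (simp add: nat_pow_mult)
  then have "a [^] j \<in> PIdl (a [^] i)" using assms by (auto simp: cgenideal_def)
  then show ?thesis using assms by (simp add: cgenideal_ideal cgenideal_minimal)
qed

text \<open>The number \<open>n\<close> is the exact nilpotency index of \<pi>. Together with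
  maximality, nilpotence makes every element outside \<open>PIdl \<pi>\<close> a unit and every
  nonzero element a unit times a power of \<pi>.\<close>

locale finite_chain_ring = cring R for R (structure) +
  fixes \<pi> :: 'a and n :: nat
  assumes finite_carrier: "finite (carrier R)"
    and pi_closed [simp]: "\<pi> \<in> carrier R"
    and maximal: "maximalideal (PIdl \<pi>) R"
    and n_pos: "n > 0"
    and pow_nonzero: "\<pi> [^] (n - 1) \<noteq> \<zero>"
    and pow_zero: "\<pi> [^] n = \<zero>"
begin

section \<open>Units, valuation and annihilators in a finite chain ring\<close>

lemma pow_eq_zero_iff: "\<pi> [^] (i::nat) = \<zero> \<longleftrightarrow> n \<le> i"
proof
  assume *: "\<pi> [^] i = \<zero>"
  show "n \<le> i"
  proof (rule ccontr)
    assume "\<not> n \<le> i"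
    then have "\<pi> [^] (n - 1) = \<pi> [^] (n - 1 - i) \<otimes> \<pi> [^] i" by (simp add: nat_pow_mult)
    then show False using pow_nonzero * by simp
  qed
next
  assume "n \<le> i"
  then have "\<pi> [^] i = \<pi> [^] (i - n) \<otimes> \<pi> [^] n" by (simp add: nat_pow_mult)
  then show "\<pi> [^] i = \<zero>" by (simp add: pow_zero)
qed

text \<open>Iteration gives \<open>x = x \<otimes> z [^] n\<close>, and \<open>z [^] n\<close> is a
  multiple of \<open>\<pi> [^] n = \<zero>\<close>. This is an instance of Nakayama's lemma.\<close>

lemma fixed_by_maximal_imp_zero:
  assumes x: "x \<in> carrier R" and z: "z \<in> PIdl \<pi>" and xz: "x = x \<otimes> z"
  shows "x = \<zero>"
proof -
  obtain c where c: "c \<in> carrier R" "z = c \<otimes> \<pi>" using z by (auto simp: cgenideal_def)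
  then have zc: "z \<in> carrier R" by simp
  have "x = x \<otimes> z [^] i" for i :: nat
  proof (induction i)
    case 0 show ?case using x by simp
  next
    case (Suc i)
    have "x \<otimes> z [^] Suc i = (x \<otimes> z [^] i) \<otimes> z" using x zc by (simp add: m_assoc)
    then show ?case using Suc xz by simp
  qed
  from this[of n] show ?thesis using x c by (simp add: nat_pow_distrib pow_zero)
qed

text \<open>Maximality yields \<open>\<one> = a \<oplus> b \<otimes> x\<close> with \<open>a\<close>
  in the ideal. If \<open>x\<close> kills \<open>z\<close>, then \<open>z = z \<otimes> a\<close>,
  so \<open>z\<close> is zero. Multiplication by \<open>x\<close> is thus injective, hence
  surjective on the finite ring.\<close>

lemma unit_if_not_in_maximal:
  assumes x: "x \<in> carrier R" "x \<notin> PIdl \<pi>"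
  shows "x \<in> Units R"
proof -
  interpret M: maximalideal "PIdl \<pi>" R by (rule maximal)
  let ?J = "PIdl \<pi> <+>\<^bsub>R\<^esub> PIdl x"
  have J: "ideal ?J R" using x by (simp add: add_ideals cgenideal_ideal)
  have zero: "\<zero> \<in> PIdl \<pi>" "\<zero> \<in> PIdl x"
    using x by (simp_all add: additive_subgroup.zero_closed ideal.axioms(1) cgenideal_ideal)
  have "PIdl \<pi> \<subseteq> ?J"
  proof
    fix y assume y: "y \<in> PIdl \<pi>"
    then have "y = y \<oplus> \<zero>" using M.a_subset by auto
    then show "y \<in> ?J" using y zero unfolding set_add_def' by blast
  qed
  moreover have "x \<in> ?J"
  proof -
    have "x = \<zero> \<oplus> x" using x by simp
    then show ?thesis using zero cgenideal_self[OF x(1)] unfolding set_add_def' by blast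
  qed
  moreover have "?J \<subseteq> carrier R" using ideal.Icarr[OF J] by (intro subsetI)
  ultimately have "?J = carrier R" using M.I_maximal[OF J] x by blast
  then have "\<one> \<in> ?J" by simp
  then obtain a c where ac: "a \<in> PIdl \<pi>" "c \<in> PIdl x" "\<one> = a \<oplus> c"
    unfolding set_add_def' by blast
  then obtain b where ab: "a \<in> PIdl \<pi>" "b \<in> carrier R" "\<one> = a \<oplus> b \<otimes> x"
    unfolding cgenideal_def[of R x] by blast
  have ac: "a \<in> carrier R" using ab M.a_subset by blast
  have "inj_on (\<lambda>y. x \<otimes> y) (carrier R)"
  proof (rule inj_onI)
    fix y y' assume y: "y \<in> carrier R" "y' \<in> carrier R" "x \<otimes> y = x \<otimes> y'"
    let ?z = "y \<ominus> y'"
    have z: "?z \<in> carrier R" "x \<otimes> ?z = \<zero>" using x y by (simp_all add: minus_eq r_distr r_minus r_neg)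
    have "?z = (a \<oplus> b \<otimes> x) \<otimes> ?z" using z ab(3) by (metis l_one)
    also have "\<dots> = ?z \<otimes> a" using z ab(2) x(1) ac by (simp add: l_distr m_assoc m_comm[of a])
    finally have "?z = \<zero>" using fixed_by_maximal_imp_zero z ab by blast
    then show "y = y'" using y by simp
  qed
  then have "(\<lambda>y. x \<otimes> y) ` carrier R = carrier R"
    using x finite_carrier by (intro endo_inj_surj) auto
  then obtain y where "y \<in> carrier R" "x \<otimes> y = \<one>" by (metis (no_types, lifting) imageE one_closed)
  moreover from this have "y \<otimes> x = \<one>" using x(1) by (simp add: m_comm)
  ultimately show ?thesis using x(1) unfolding Units_def by blast
qed

text \<open>Factors \<pi> are split off as long as the cofactor lies in \<open>PIdl \<pi>\<close>; a
  cofactor outside is a unit. For nonzero \<open>x\<close> this ends below exponent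
  \<open>n\<close>, because \<open>\<pi> [^] n = \<zero>\<close>.\<close>

lemma valuation:
  assumes x: "x \<in> carrier R" "x \<noteq> \<zero>"
  obtains a e where "a < n" "e \<in> Units R" "x = e \<otimes> \<pi> [^] a"
proof -
  have "x \<in> PIdl (\<pi> [^] i) \<or> (\<exists>a<i. \<exists>e\<in>Units R. x = e \<otimes> \<pi> [^] a)" for i :: nat
  proof (induct i)
    case 0
    have "x = x \<otimes> \<pi> [^] (0::nat)" using x by simp
    then show ?case using x unfolding cgenideal_def by blast
  next
    case (Suc i)
    then show ?case
    proof
      assume "x \<in> PIdl (\<pi> [^] i)"
      then obtain t where t: "t \<in> carrier R" "x = t \<otimes> \<pi> [^] i" by (auto simp: cgenideal_def)
      show ?thesis
      proof (cases "t \<in> PIdl \<pi>")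
        case True
        then obtain c where "c \<in> carrier R" "t = c \<otimes> \<pi>" by (auto simp: cgenideal_def)
        then have "x = c \<otimes> \<pi> [^] Suc i" using t by (simp add: m_assoc m_comm[of \<pi>])
        then show ?thesis using \<open>c \<in> carrier R\<close> unfolding cgenideal_def by blast
      next
        case False
        then show ?thesis using unit_if_not_in_maximal t by blast
      qed
    next
      assume "\<exists>a<i. \<exists>e\<in>Units R. x = e \<otimes> \<pi> [^] a"
      then show ?thesis using less_SucI by blast
    qed
  qed
  from this[of n] show thesis using that x by (auto simp: cgenideal_def pow_zero)
qed

text \<open>For \<open>x = e \<otimes> \<pi> [^] b\<close> with a unit \<open>e\<close>, the product
  vanishes exactly when \<open>a + b \<ge> n\<close>.\<close>

lemma annihilator_iff:
  assumes x: "x \<in> carrier R" and a: "a < n"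
  shows "\<pi> [^] a \<otimes> x = \<zero> \<longleftrightarrow> x \<in> PIdl (\<pi> [^] (n - a))"
proof
  assume *: "\<pi> [^] a \<otimes> x = \<zero>"
  show "x \<in> PIdl (\<pi> [^] (n - a))"
  proof (cases "x = \<zero>")
    case True
    then show ?thesis by (simp add: additive_subgroup.zero_closed ideal.axioms(1) cgenideal_ideal)
  next
    case False
    then obtain b e where b: "b < n" "e \<in> Units R" "x = e \<otimes> \<pi> [^] b" using valuation x by blast
    then have "e \<otimes> \<pi> [^] (a + b) = \<zero>"
      using * Units_closed[OF b(2)] by (simp add: m_lcomm nat_pow_mult)
    then have "\<pi> [^] (a + b) = \<zero>" using b(2) by (metis Units_closed Units_l_cancel nat_pow_closed pi_closed r_null zero_closed)
    then have "n - a \<le> b" by (simp add: pow_eq_zero_iff)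
    then have "PIdl (\<pi> [^] b) \<subseteq> PIdl (\<pi> [^] (n - a))" by (rule PIdl_pow_antimono[OF pi_closed])
    moreover have "x \<in> PIdl (\<pi> [^] b)" using b(3) Units_closed[OF b(2)] by (auto simp: cgenideal_def)
    ultimately show ?thesis by blast
  qed
next
  assume "x \<in> PIdl (\<pi> [^] (n - a))"
  then obtain c where "c \<in> carrier R" "x = c \<otimes> \<pi> [^] (n - a)" by (auto simp: cgenideal_def)
  moreover have "\<pi> [^] a \<otimes> \<pi> [^] (n - a) = \<zero>" using a by (simp add: nat_pow_mult pow_zero)
  ultimately show "\<pi> [^] a \<otimes> x = \<zero>" by (simp add: m_lcomm)
qed

text \<open>The unit \<open>e\<close> cancels, so two solutions differ by an element annihilated by
  \<open>\<pi> [^] a\<close>.\<close>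

lemma solution_set:
  assumes e: "e \<in> Units R" and a: "a < n" and r0: "r0 \<in> carrier R"
  defines "x \<equiv> e \<otimes> \<pi> [^] a"
  shows "{r \<in> carrier R. x \<otimes> r = x \<otimes> r0} = r0 <+ PIdl (\<pi> [^] (n - a))"
proof -
  let ?J = "PIdl (\<pi> [^] (n - a))"
  have J: "?J \<subseteq> carrier R" by (auto simp: cgenideal_def)
  have "x \<otimes> r = x \<otimes> r0 \<longleftrightarrow> r \<in> r0 <+ ?J" if r: "r \<in> carrier R" for r
  proof -
    have ec: "e \<in> carrier R" using e by (rule Units_closed)
    have "x \<otimes> r = x \<otimes> r0 \<longleftrightarrow> \<pi> [^] a \<otimes> r = \<pi> [^] a \<otimes> r0"
      using e ec r r0 by (simp add: x_def m_assoc Units_l_cancel)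
    also have "\<dots> \<longleftrightarrow> \<pi> [^] a \<otimes> r \<ominus> \<pi> [^] a \<otimes> r0 = \<zero>"
      using r r0 by (simp add: r_right_minus_eq)
    also have "\<pi> [^] a \<otimes> r \<ominus> \<pi> [^] a \<otimes> r0 = \<pi> [^] a \<otimes> (r \<ominus> r0)"
      using r r0 by (simp add: minus_eq r_distr r_minus)
    also have "\<pi> [^] a \<otimes> (r \<ominus> r0) = \<zero> \<longleftrightarrow> r \<in> r0 <+ ?J"
      using r r0 a J by (simp add: annihilator_iff mem_l_coset_iff)
    finally show ?thesis .
  qed
  moreover have "r0 <+ ?J \<subseteq> carrier R" using r0 J by (auto simp: a_l_coset_def')
  ultimately show ?thesis by blast
qed

section \<open>Digit expansions in powers of \<pi>\<close>

lemma digit_sums_closed: "T \<subseteq> carrier R \<Longrightarrow> digit_sums R \<pi> T i \<subseteq> carrier R"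
  by (induct i) (auto simp: set_add_def' l_coset_def subset_iff)

text \<open>As \<zero> is a digit, a shorter expansion can be padded with zeros.\<close>

lemma digit_sums_mono:
  assumes T: "T \<subseteq> carrier R" "\<zero> \<in> T" and "i \<le> j"
  shows "digit_sums R \<pi> T i \<subseteq> digit_sums R \<pi> T j"
  using \<open>i \<le> j\<close>
proof (induction rule: dec_induct)
  case (step j)
  have "u \<in> digit_sums R \<pi> T (Suc j)" if u: "u \<in> digit_sums R \<pi> T j" for u
  proof -
    have "u = u \<oplus> \<pi> [^] j \<otimes> \<zero>" using subsetD[OF digit_sums_closed[OF T(1)] u] by simp
    moreover have "\<pi> [^] j \<otimes> \<zero> \<in> \<pi> [^] j <# T" using T(2) unfolding l_coset_def by blast
    ultimately show ?thesis using u unfolding digit_sums.simps set_add_def' by blast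
  qed
  then show ?case using step by blast
qed simp

lemma digit_sums_one: "T \<subseteq> carrier R \<Longrightarrow> digit_sums R \<pi> T 1 = T"
  by (force simp: set_add_def' l_coset_def)

text \<open>The remainder after \<open>i\<close> digits is \<open>c \<otimes> \<pi> [^] i\<close>;
  the next digit is the representative of \<open>c\<close> modulo \<pi>.\<close>

lemma digit_expansion:
  assumes T: "coset_reps R (PIdl \<pi>) T" and x: "x \<in> carrier R"
  obtains u where "u \<in> digit_sums R \<pi> T i" "x \<in> u <+ PIdl (\<pi> [^] i)"
proof -
  have Tc: "T \<subseteq> carrier R" using T by (simp add: coset_reps_def)
  have "\<exists>u\<in>digit_sums R \<pi> T i. x \<in> u <+ PIdl (\<pi> [^] i)"
  proof (induct i)
    case 0
    have "x = \<zero> \<oplus> x \<otimes> \<one>" using x by simp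
    then show ?case using x by (auto simp: a_l_coset_def' cgenideal_def)
  next
    case (Suc i)
    then obtain u c where u: "u \<in> digit_sums R \<pi> T i" "c \<in> carrier R" "x = u \<oplus> c \<otimes> \<pi> [^] i"
      by (auto simp: a_l_coset_def' cgenideal_def)
    obtain t where t: "t \<in> T" "c \<in> t <+ PIdl \<pi>"
      using coset_reps_cover[OF _ T u(2)] by (auto simp: cgenideal_ideal)
    then obtain b where b: "b \<in> carrier R" "c = t \<oplus> b \<otimes> \<pi>" by (auto simp: a_l_coset_def' cgenideal_def)
    have uc: "u \<in> carrier R" and tc: "t \<in> carrier R" using u t Tc digit_sums_closed by blast+
    have "x = (u \<oplus> \<pi> [^] i \<otimes> t) \<oplus> b \<otimes> \<pi> [^] Suc i"
      using uc tc b(1) unfolding u(3) b(2) by (simp add: l_distr a_assoc m_assoc m_comm[of t] m_comm[of \<pi>])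
    moreover have "u \<oplus> \<pi> [^] i \<otimes> t \<in> digit_sums R \<pi> T (Suc i)"
      using u t by (auto simp: set_add_def' l_coset_def)
    ultimately show ?case using b by (auto simp: a_l_coset_def' cgenideal_def)
  qed
  then show thesis using that by blast
qed

text \<open>The products \<open>\<pi> \<otimes> t\<close> with \<open>t\<close> in \<open>T\<close>
  represent the cosets of the square of the maximal ideal inside the maximal ideal.\<close>

lemma sum_pi_coset_reps:
  fixes f :: "'a \<Rightarrow> complex"
  assumes n: "n \<ge> 2" and T: "coset_reps R (PIdl \<pi>) T"
  shows "(\<Sum>v\<in>\<pi> <# T. \<Sum>s\<in>v <+ PIdl (\<pi> [^] (2::nat)). f s) = (\<Sum>s\<in>PIdl \<pi>. f s)"
proof -
  let ?J = "PIdl (\<pi> [^] (2::nat))"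
  have Tc: "T \<subseteq> carrier R" using T by (simp add: coset_reps_def)
  have J: "ideal ?J R" by (simp add: cgenideal_ideal)
  interpret J: ideal ?J R by (rule J)
  interpret M: ideal "PIdl \<pi>" R by (simp add: cgenideal_ideal)
  have JM: "?J \<subseteq> PIdl \<pi>" using PIdl_pow_antimono[of \<pi> 1 2] by simp
  have v: "v \<in> PIdl \<pi>" if vT: "v \<in> \<pi> <# T" for v
  proof -
    obtain t where "t \<in> T" "v = \<pi> \<otimes> t" using vT by (auto simp: l_coset_def)
    then have "t \<in> carrier R" "v = t \<otimes> \<pi>" using Tc by (auto intro: m_comm)
    then show ?thesis unfolding cgenideal_def by blast
  qed
  have sub: "v <+ ?J \<subseteq> PIdl \<pi>" if "v \<in> \<pi> <# T" for v
    using v[OF that] JM by (auto simp: a_l_coset_def')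
  have fM: "finite (PIdl \<pi>)" by (rule finite_subset[OF M.a_subset finite_carrier])
  have "PIdl \<pi> \<subseteq> (\<Union>v\<in>\<pi> <# T. v <+ ?J)"
  proof
    fix s assume "s \<in> PIdl \<pi>"
    then obtain c where c: "c \<in> carrier R" "s = c \<otimes> \<pi>" unfolding cgenideal_def by blast
    obtain t where t: "t \<in> T" "c \<in> t <+ PIdl \<pi>"
      using coset_reps_cover[OF M.is_ideal T c(1)] by blast
    then obtain b where b: "b \<in> carrier R" "c = t \<oplus> b \<otimes> \<pi>"
      unfolding a_l_coset_def' cgenideal_def by blast
    have "t \<in> carrier R" using t Tc by blast
    then have "s = \<pi> \<otimes> t \<oplus> b \<otimes> \<pi> [^] (2::nat)"
      using b(1) unfolding c(2) b(2) by (simp add: l_distr m_assoc m_comm[of t] numeral_2_eq_2)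
    then show "s \<in> (\<Union>v\<in>\<pi> <# T. v <+ ?J)"
      using t(1) b(1) unfolding a_l_coset_def' cgenideal_def l_coset_def by blast
  qed
  then have "PIdl \<pi> = (\<Union>v\<in>\<pi> <# T. v <+ ?J)" using sub by (intro equalityI UN_least)
  moreover have "(\<Sum>s\<in>(\<Union>v\<in>\<pi> <# T. v <+ ?J). f s) = (\<Sum>v\<in>\<pi> <# T. \<Sum>s\<in>v <+ ?J. f s)"
  proof (rule sum.UNION_disjoint)
    show "finite (\<pi> <# T)" by (rule finite_subset[OF subsetI[OF v] fM])
    show "\<forall>v\<in>\<pi> <# T. finite (v <+ ?J)" using finite_subset[OF sub fM] by blast
    show "\<forall>v\<in>\<pi> <# T. \<forall>v'\<in>\<pi> <# T. v \<noteq> v' \<longrightarrow> (v <+ ?J) \<inter> (v' <+ ?J) = {}"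
    proof (intro ballI impI equals0I)
      fix v v' x assume *: "v \<in> \<pi> <# T" "v' \<in> \<pi> <# T" "v \<noteq> v'" "x \<in> (v <+ ?J) \<inter> (v' <+ ?J)"
      have vc: "v \<in> carrier R" "v' \<in> carrier R"
        using subsetD[OF M.a_subset v] *(1,2) by auto
      have "v <+ ?J = v' <+ ?J" using l_coset_eqI[OF J vc(1)] l_coset_eqI[OF J vc(2)] *(4) by (metis IntE)
      moreover have "v \<in> v <+ ?J" using vc J.a_subset by (subst mem_l_coset_iff) (auto simp: minus_eq r_neg)
      ultimately have "v \<ominus> v' \<in> ?J" using vc J.a_subset by (subst mem_l_coset_iff[symmetric]) auto
      then obtain c where c: "c \<in> carrier R" "v \<ominus> v' = c \<otimes> \<pi> [^] (2::nat)"
        unfolding cgenideal_def by blast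
      obtain t t' where t: "t \<in> T" "t' \<in> T" "v = \<pi> \<otimes> t" "v' = \<pi> \<otimes> t'"
        using *(1,2) unfolding l_coset_def by blast
      have tc: "t \<in> carrier R" "t' \<in> carrier R" using t Tc by blast+
      have "\<pi> \<otimes> (t \<ominus> t') = \<pi> \<otimes> (c \<otimes> \<pi>)"
        using c t tc by (simp add: minus_eq r_distr r_minus numeral_2_eq_2 m_lcomm m_comm)
      \<comment> \<open>Although \<pi> cannot be cancelled, it kills only
        \<open>PIdl (\<pi> [^] (n - 1))\<close>, which lies in \<open>PIdl \<pi>\<close> since
        \<open>n \<ge> 2\<close>. Hence \<open>t\<close> and \<open>t'\<close> are still congruent
        modulo \<pi>.\<close>
      then have "\<pi> [^] (1::nat) \<otimes> ((t \<ominus> t') \<ominus> c \<otimes> \<pi>) = \<zero>"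
        using c tc by (simp add: minus_eq[of "t \<ominus> t'"] r_distr r_minus r_neg)
      then have "(t \<ominus> t') \<ominus> c \<otimes> \<pi> \<in> PIdl (\<pi> [^] (n - 1))"
        using n c(1) tc by (intro annihilator_iff[THEN iffD1]) simp_all
      moreover have "PIdl (\<pi> [^] (n - 1)) \<subseteq> PIdl (\<pi> [^] (1::nat))" using n by (intro PIdl_pow_antimono) simp_all
      ultimately have "(t \<ominus> t') \<ominus> c \<otimes> \<pi> \<in> PIdl (\<pi> [^] (1::nat))" by (rule rev_subsetD)
      then have "(t \<ominus> t') \<ominus> c \<otimes> \<pi> \<in> PIdl \<pi>" by simp
      moreover have "c \<otimes> \<pi> \<in> PIdl \<pi>" using c unfolding cgenideal_def by blast
      ultimately have "((t \<ominus> t') \<ominus> c \<otimes> \<pi>) \<oplus> c \<otimes> \<pi> \<in> PIdl \<pi>" by (rule M.a_closed)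
      moreover have "((t \<ominus> t') \<ominus> c \<otimes> \<pi>) \<oplus> c \<otimes> \<pi> = t \<ominus> t'"
        using c tc by (simp add: minus_eq a_assoc l_neg)
      ultimately have "t = t'" using coset_reps_unique[OF M.is_ideal T t(1,2)] by simp
      then show False using * t by simp
    qed
  qed
  ultimately show ?thesis by simp
qed

section \<open>A generating character, and line sums as sums over cosets\<close>

lemma ex_generating_character:
  obtains \<psi> where "generating_character R \<psi>"
proof -
  obtain \<psi> :: "'a \<Rightarrow> complex"
    where add: "\<And>x y. x \<in> carrier R \<Longrightarrow> y \<in> carrier R \<Longrightarrow> \<psi> (x \<oplus> y) = \<psi> x * \<psi> y"
      and norm: "\<And>x. x \<in> carrier R \<Longrightarrow> norm (\<psi> x) = 1"
      and nontriv: "\<psi> (\<pi> [^] (n - 1)) \<noteq> 1"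
    by (rule add.ex_character_separating[OF finite_carrier nat_pow_closed[OF pi_closed] pow_nonzero]) blast
  \<comment> \<open>Every nonzero \<open>z\<close> has \<open>\<pi> [^] (n - 1)\<close> among its
    multiples: the multiplier removes the unit part and supplies the missing power of \<pi>.\<close>
  have "\<exists>x\<in>carrier R. \<psi> (x \<otimes> z) \<noteq> 1" if z: "z \<in> carrier R" "z \<noteq> \<zero>" for z
  proof -
    obtain a e where a: "a < n" "e \<in> Units R" "z = e \<otimes> \<pi> [^] a" using valuation z by blast
    have ec: "e \<in> carrier R" using a(2) by (rule Units_closed)
    let ?x = "inv e \<otimes> \<pi> [^] (n - 1 - a)"
    have "?x \<otimes> z = (inv e \<otimes> e) \<otimes> (\<pi> [^] (n - 1 - a) \<otimes> \<pi> [^] a)"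
      using a ec by (simp add: m_ac) (simp flip: m_assoc)
    also have "\<dots> = \<pi> [^] (n - 1)" using a by (simp add: nat_pow_mult)
    finally show ?thesis using nontriv a by (intro bexI[of _ ?x]) auto
  qed
  then have "generating_character R \<psi>"
    using add norm finite_carrier by unfold_locales auto
  then show thesis by (rule that)
qed

text \<open>The coordinate of smaller valuation divides the other one, so exactly one of the two
  equations is solvable, and \<open>solution_set\<close> describes its solutions. For equal
  valuations it is the first equation, because the second admits only parameters in
  \<open>PIdl \<pi>\<close>.\<close>

lemma line_sum_eq_coset_sum:
  assumes xy: "x \<in> carrier R" "y \<in> carrier R" "(x, y) \<noteq> (\<zero>, \<zero>)"
  shows "(\<exists>a<n. \<exists>r\<in>carrier R. line_sum R (PIdl \<pi>) \<eta> \<mu> (x, y) = sum \<eta> (r <+ PIdl (\<pi> [^] (n - a)))) \<or>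
    (\<exists>b<n. \<exists>s\<in>PIdl \<pi>. line_sum R (PIdl \<pi>) \<eta> \<mu> (x, y) = sum \<mu> (s <+ PIdl (\<pi> [^] (n - b))))"
proof -
  interpret M: ideal "PIdl \<pi>" R by (simp add: cgenideal_ideal)
  have D: "line_sum R (PIdl \<pi>) \<eta> \<mu> (x, y) =
      sum \<eta> {r \<in> carrier R. x \<otimes> r = y} + sum \<mu> {s \<in> PIdl \<pi>. y \<otimes> s = x}"
    by (rule line_sum_eq[OF finite_carrier M.a_subset xy(1,2)])
  \<comment> \<open>Solving both equations gives \<open>x = x \<otimes> (r \<otimes> s)\<close> with
    \<open>r \<otimes> s\<close> in the maximal ideal.\<close>
  have exclusive: "x = \<zero> \<and> y = \<zero>"
    if "r \<in> carrier R" "x \<otimes> r = y" "s \<in> PIdl \<pi>" "y \<otimes> s = x" for r s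
  proof -
    have s: "s \<in> carrier R" using that(3) M.a_subset by blast
    have "r \<otimes> s \<in> PIdl \<pi>" using that(1,3) by (rule M.I_l_closed[rotated])
    moreover have "x = x \<otimes> (r \<otimes> s)" using that xy(1) s by (simp flip: m_assoc)
    ultimately have "x = \<zero>" by (intro fixed_by_maximal_imp_zero xy(1))
    then show ?thesis using that(1,2) by simp
  qed
  have quotient: "f \<otimes> \<pi> [^] b = (e \<otimes> \<pi> [^] a) \<otimes> ((inv e \<otimes> f) \<otimes> \<pi> [^] (b - a))"
    if "e \<in> Units R" "f \<in> Units R" "a \<le> b" for e f and a b :: nat
  proof -
    have c: "e \<in> carrier R" "f \<in> carrier R" "inv e \<in> carrier R" using that by auto
    have "(e \<otimes> \<pi> [^] a) \<otimes> ((inv e \<otimes> f) \<otimes> \<pi> [^] (b - a)) = (e \<otimes> inv e) \<otimes> f \<otimes> (\<pi> [^] a \<otimes> \<pi> [^] (b - a))"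
      using c by (simp add: m_ac)
    also have "\<dots> = f \<otimes> \<pi> [^] b" using that c by (simp add: nat_pow_mult)
    finally show ?thesis by simp
  qed
  have on_I: ?thesis if x0: "x \<noteq> \<zero>" and r: "r \<in> carrier R" "x \<otimes> r = y" for r
  proof -
    obtain a e where a: "a < n" "e \<in> Units R" "x = e \<otimes> \<pi> [^] a" using valuation xy(1) x0 by blast
    have "{s \<in> PIdl \<pi>. y \<otimes> s = x} = {}" using exclusive[OF r] x0 by blast
    moreover have "{r' \<in> carrier R. x \<otimes> r' = y} = r <+ PIdl (\<pi> [^] (n - a))"
      using solution_set[OF a(2,1) r(1)] a(3) r(2) by simp
    ultimately have "line_sum R (PIdl \<pi>) \<eta> \<mu> (x, y) = sum \<eta> (r <+ PIdl (\<pi> [^] (n - a)))"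
      by (simp only: D sum.empty add_0_right)
    then show ?thesis using a(1) r(1) by blast
  qed
  have on_J: ?thesis if y0: "y \<noteq> \<zero>" and s: "s \<in> PIdl \<pi>" "y \<otimes> s = x" for s
  proof -
    have sc: "s \<in> carrier R" using s(1) M.a_subset by blast
    obtain b f where b: "b < n" "f \<in> Units R" "y = f \<otimes> \<pi> [^] b" using valuation xy(2) y0 by blast
    let ?J = "PIdl (\<pi> [^] (n - b))"
    \<comment> \<open>As \<open>b < n\<close>, the exponent \<open>n - b\<close> is at least 1, so
      the whole solution coset of \<open>s\<close> consists of admissible parameters.\<close>
    have "?J \<subseteq> PIdl (\<pi> [^] (1::nat))" using b(1) by (intro PIdl_pow_antimono) simp_all
    then have JM: "?J \<subseteq> PIdl \<pi>" by simp
    have "s \<oplus> j \<in> PIdl \<pi>" if "j \<in> ?J" for j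
      using s(1) subsetD[OF JM that] by (rule M.a_closed)
    then have "s <+ ?J \<subseteq> PIdl \<pi>" unfolding a_l_coset_def' by blast
    moreover have "{s' \<in> carrier R. y \<otimes> s' = x} = s <+ ?J"
      using solution_set[OF b(2,1) sc] b(3) s(2) by simp
    ultimately have "{s' \<in> PIdl \<pi>. y \<otimes> s' = x} = s <+ ?J" using M.a_subset by blast
    moreover have "{r \<in> carrier R. x \<otimes> r = y} = {}" using exclusive[OF _ _ s] y0 by blast
    ultimately have "line_sum R (PIdl \<pi>) \<eta> \<mu> (x, y) = sum \<mu> (s <+ ?J)"
      by (simp only: D sum.empty add_0_left)
    then show ?thesis using b(1) s(1) by blast
  qed
  consider (left) "x = \<zero>" "y \<noteq> \<zero>" | (right) "x \<noteq> \<zero>" "y = \<zero>" | (both) "x \<noteq> \<zero>" "y \<noteq> \<zero>" using xy(3) by auto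
  then show ?thesis
  proof cases
    case left
    then show ?thesis using on_J[of \<zero>] xy(2) by simp
  next
    case right
    then show ?thesis using on_I[of \<zero>] xy(1) by simp
  next
    case xy': both
    obtain a e where "a < n" and a: "e \<in> Units R" "x = e \<otimes> \<pi> [^] a"
      by (rule valuation[OF xy(1) xy'(1)])
    obtain b f where "b < n" and b: "f \<in> Units R" "y = f \<otimes> \<pi> [^] b"
      by (rule valuation[OF xy(2) xy'(2)])
    have c: "e \<in> carrier R" "f \<in> carrier R" "inv e \<in> carrier R" "inv f \<in> carrier R"
      using a(1) b(1) by (simp_all add: Units_closed)
    show ?thesis
    proof (cases "a \<le> b")
      case True
      show ?thesis
        using on_I[OF xy'(1), of "(inv e \<otimes> f) \<otimes> \<pi> [^] (b - a)"] quotient[OF a(1) b(1) True] c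
        by (simp add: a(2) b(2))
    next
      case False
      \<comment> \<open>Here \<open>a > b\<close> strictly, so the quotient contains a factor \<pi>
        and is an admissible parameter of the second family.\<close>
      let ?s = "(inv f \<otimes> e) \<otimes> \<pi> [^] (a - b)"
      have "PIdl (\<pi> [^] (a - b)) \<subseteq> PIdl (\<pi> [^] (1::nat))" using False by (intro PIdl_pow_antimono) simp_all
      moreover have "?s \<in> PIdl (\<pi> [^] (a - b))" using c unfolding cgenideal_def by blast
      ultimately have "?s \<in> PIdl \<pi>" by auto
      moreover have "y \<otimes> ?s = x" using quotient[OF b(1) a(1), of b a] False by (simp add: a(2) b(2))
      ultimately show ?thesis by (rule on_J[OF xy'(2)])
    qed
  qed
qed

end

section \<open>Coefficients of \<open>D\<close> as roots of unity, and the resulting Butson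
  matrix\<close>

theorem theorem4p6:
  fixes R :: "('a, 'b) ring_scheme"
    and p d m n h :: nat
    and I R1 :: "'a set"
    and \<pi> w :: 'a
    and \<zeta> \<eta> :: complex
    and \<eta>r \<delta> \<mu> \<gamma> :: "'a \<Rightarrow> complex"
    and D :: "'a \<times> 'a \<Rightarrow> complex"
  assumes "Factorial_Ring.prime p" and "d > 0" and "m > 0" and "n > 0" and "h > 0"
    and "finite (carrier R)" and "local_ring_with R I" and "order R = p ^ (d * n)"
    and "\<pi> \<in> carrier R" and "I = Idl\<^bsub>R\<^esub> {\<pi>}"
    and "\<pi> [^]\<^bsub>R\<^esub> (n - 1) \<noteq> \<zero>\<^bsub>R\<^esub>" and "\<pi> [^]\<^bsub>R\<^esub> n = \<zero>\<^bsub>R\<^esub>"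
    and "w \<in> Units R" and "[p] \<cdot>\<^bsub>R\<^esub> \<one>\<^bsub>R\<^esub> = \<pi> [^]\<^bsub>R\<^esub> m \<otimes>\<^bsub>R\<^esub> w"
    and "field (R Quot I)" and "order (R Quot I) = p ^ d"
    and "coset_reps R I R1" and "\<zero>\<^bsub>R\<^esub> \<in> R1"
    and "primitive_root_of_unity h \<zeta>"
    and "root_of_unity h \<eta>"
    and "\<forall>r \<in> carrier R. root_of_unity h (\<eta>r r)"
    and "\<forall>u \<in> digit_sums R \<pi> R1 (n - 1). root_of_unity h (\<delta> u)"
    and "\<forall>s \<in> I. root_of_unity h (\<mu> s)"
    and "n \<ge> 2 \<longrightarrow> (\<forall>v \<in> \<pi> <#\<^bsub>R\<^esub> digit_sums R \<pi> R1 (n - 2). root_of_unity h (\<gamma> v))"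
    and "\<forall>i. 1 \<le> i \<and> i + 1 \<le> n \<longrightarrow>
           (\<forall>u \<in> digit_sums R \<pi> R1 i. (\<Sum>r \<in> u <+\<^bsub>R\<^esub> ideal_power R I i. \<eta>r r) = \<delta> u)"
    and "\<forall>j. j + 2 \<le> n \<longrightarrow>
           (\<forall>v \<in> \<pi> <#\<^bsub>R\<^esub> digit_sums R \<pi> R1 j.
              (\<Sum>s \<in> v <+\<^bsub>R\<^esub> ideal_power R I (j + 1). \<mu> s) = \<gamma> v)"
    and "n \<ge> 3 \<longrightarrow> (\<Sum>u \<in> R1. \<delta> u) + (\<Sum>v \<in> \<pi> <#\<^bsub>R\<^esub> R1. \<gamma> v) = \<eta>"
    and "n = 2 \<longrightarrow> (\<Sum>u \<in> R1. \<delta> u) + \<gamma> \<zero>\<^bsub>R\<^esub> = \<eta>"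
    and "n = 1 \<longrightarrow> (\<Sum>u \<in> R1. \<eta>r u) + \<mu> \<zero>\<^bsub>R\<^esub> = \<eta>"
    and "D = (\<lambda>g. (\<Sum>r \<in> carrier R. \<eta>r r * indicator (line_I R r) g)
                + (\<Sum>s \<in> I. \<mu> s * indicator (line_J R s) g))"
  shows "D \<in> group_ring (int_adjoin \<zeta>) (add_square R)
    \<and> (\<forall>g \<in> carrier (add_square R). root_of_unity h (D g))
    \<and> gr_mult (add_square R) D (gr_star (add_square R) D)
        = gr_const (add_square R) (int (order (add_square R)))
    \<and> (\<exists>H. BH_matrix (add_square R) h H)"
proof -
  interpret cring R using assms(7) by (simp add: local_ring_with_def)
  have I: "I = PIdl\<^bsub>R\<^esub> \<pi>" using assms(9,10) by (simp add: cgenideal_eq_genideal)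
  have power: "ideal_power R I i = PIdl\<^bsub>R\<^esub> (\<pi> [^]\<^bsub>R\<^esub> i)" for i
    unfolding assms(10) using assms(9) by (rule ideal_power_principal)
  have "maximalideal I R" using assms(7) by (simp add: local_ring_with_def)
  then interpret finite_chain_ring R \<pi> n
    using is_cring assms(4,6,9,11,12)
    by (intro finite_chain_ring.intro finite_chain_ring_axioms.intro) (simp_all flip: I)
  interpret M: ideal I R using assms(7) by (simp add: local_ring_with_def maximalideal_def)
  note reps = assms(17)[unfolded I]
  have R1c: "R1 \<subseteq> carrier R" using assms(17) by (simp add: coset_reps_def)
  note mono = digit_sums_mono[OF R1c assms(18)]
  have \<delta>: "sum \<eta>r (u <+\<^bsub>R\<^esub> PIdl\<^bsub>R\<^esub> (\<pi> [^]\<^bsub>R\<^esub> i)) = \<delta> u"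
    if "1 \<le> i" "i < n" "u \<in> digit_sums R \<pi> R1 i" for i u
    using assms(25)[unfolded power] that by simp
  have \<gamma>: "sum \<mu> (v <+\<^bsub>R\<^esub> PIdl\<^bsub>R\<^esub> (\<pi> [^]\<^bsub>R\<^esub> (j + 1))) = \<gamma> v"
    if "j + 2 \<le> n" "v \<in> \<pi> <#\<^bsub>R\<^esub> digit_sums R \<pi> R1 j" for j v
    using assms(26)[unfolded power] that by simp
  have D: "D = line_sum R I \<eta>r \<mu>" by (simp add: assms(30) line_sum_def fun_eq_iff)
  have zero_coset: "u <+\<^bsub>R\<^esub> {\<zero>\<^bsub>R\<^esub>} = {u}" if "u \<in> carrier R" for u
    using that by (simp add: a_l_coset_def')
  have pow_n: "PIdl\<^bsub>R\<^esub> (\<pi> [^]\<^bsub>R\<^esub> n) = {\<zero>\<^bsub>R\<^esub>}" using cgenideal_eq_genideal[of "\<zero>\<^bsub>R\<^esub>"] genideal_zero by (simp add: pow_zero)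
  \<comment> \<open>The origin lies on every line, so this total is the coefficient of
    \<open>D\<close> there.\<close>
  have total: "sum \<eta>r (carrier R) + sum \<mu> I = \<eta>"
  proof -
    have "sum \<eta>r (carrier R) = (\<Sum>u\<in>R1. sum \<eta>r (u <+\<^bsub>R\<^esub> I))"
      using sum_coset_reps[OF finite_carrier M.is_ideal assms(17), of \<eta>r] by simp
    moreover have "sum \<eta>r (u <+\<^bsub>R\<^esub> I) = \<delta> u" if "u \<in> R1" "n \<ge> 2" for u
    proof -
      have "u \<in> digit_sums R \<pi> R1 1" unfolding digit_sums_one[OF R1c] by (rule that(1))
      with \<delta>[of 1 u] that(2) show ?thesis by (simp add: I)
    qed
    ultimately have big: "sum \<eta>r (carrier R) = (\<Sum>u\<in>R1. \<delta> u)" if "n \<ge> 2" using that by simp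
    \<comment> \<open>For \<open>n = 1\<close> the ideal is zero. For \<open>n = 2\<close> it is the
      single coset of \<zero>, the case \<open>j = 0\<close> of the hypothesis on \<mu>. For
      \<open>n \<ge> 3\<close> it splits into cosets of its square, the case
      \<open>j = 1\<close>.\<close>
    consider "n = 1" | "n = 2" | "n \<ge> 3" using n_pos by linarith
    then show ?thesis
    proof cases
      case 1
      then have "I = {\<zero>\<^bsub>R\<^esub>}" using pow_n by (simp add: I)
      then have "sum \<eta>r (carrier R) = (\<Sum>u\<in>R1. \<eta>r u)"
        using \<open>sum \<eta>r (carrier R) = (\<Sum>u\<in>R1. sum \<eta>r (u <+\<^bsub>R\<^esub> I))\<close> R1c
        by (auto simp: zero_coset intro!: sum.cong)
      then show ?thesis using assms(29) 1 \<open>I = {\<zero>\<^bsub>R\<^esub>}\<close> by simp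
    next
      case 2
      have "\<zero>\<^bsub>R\<^esub> <+\<^bsub>R\<^esub> I = I" using M.a_subset by (force simp: a_l_coset_def')
      then have "sum \<mu> I = \<gamma> \<zero>\<^bsub>R\<^esub>" using \<gamma>[of 0 "\<zero>\<^bsub>R\<^esub>"] 2 by (simp add: I l_coset_def)
      then show ?thesis using big assms(28) 2 by simp
    next
      case 3
      have "sum \<mu> (v <+\<^bsub>R\<^esub> PIdl\<^bsub>R\<^esub> (\<pi> [^]\<^bsub>R\<^esub> (2::nat))) = \<gamma> v" if "v \<in> \<pi> <#\<^bsub>R\<^esub> R1" for v
      proof -
        have "v \<in> \<pi> <#\<^bsub>R\<^esub> digit_sums R \<pi> R1 1" unfolding digit_sums_one[OF R1c] by (rule that)
        with 3 have "sum \<mu> (v <+\<^bsub>R\<^esub> PIdl\<^bsub>R\<^esub> (\<pi> [^]\<^bsub>R\<^esub> (1 + 1 :: nat))) = \<gamma> v" by (intro \<gamma>) simp_all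
        then show ?thesis by (simp only: one_add_one)
      qed
      then have "sum \<mu> I = (\<Sum>v\<in>\<pi> <#\<^bsub>R\<^esub> R1. \<gamma> v)"
        using sum_pi_coset_reps[OF _ reps, of \<mu>] 3 by (simp add: I)
      then show ?thesis using big assms(27) 3 by simp
    qed
  qed
  \<comment> \<open>For \<open>a = 0\<close> the coset is a single point and its weight is a root of
    unity by hypothesis. Otherwise \<open>r\<close> is replaced by its truncated expansion in the
    same coset.\<close>
  have on_I: "root_of_unity h (sum \<eta>r (r <+\<^bsub>R\<^esub> PIdl\<^bsub>R\<^esub> (\<pi> [^]\<^bsub>R\<^esub> (n - a))))"
    if "a < n" and r: "r \<in> carrier R" for a r
  proof (cases "a = 0")
    case True
    then show ?thesis using assms(21) r by (simp add: pow_n zero_coset)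
  next
    case False
    obtain u where u: "u \<in> digit_sums R \<pi> R1 (n - a)" "r \<in> u <+\<^bsub>R\<^esub> PIdl\<^bsub>R\<^esub> (\<pi> [^]\<^bsub>R\<^esub> (n - a))"
      by (rule digit_expansion[OF reps r])
    have "u \<in> carrier R" using u(1) digit_sums_closed[OF R1c] by blast
    then have "sum \<eta>r (r <+\<^bsub>R\<^esub> PIdl\<^bsub>R\<^esub> (\<pi> [^]\<^bsub>R\<^esub> (n - a))) = \<delta> u"
      using l_coset_eqI[OF _ _ u(2)] \<delta>[OF _ _ u(1)] False \<open>a < n\<close> by (simp add: cgenideal_ideal)
    \<comment> \<open>The values of \<delta> are known to be roots of unity on expansions of length
      \<open>n - 1\<close>, and \<open>a > 0\<close> gives \<open>n - a \<le> n - 1\<close>.\<close>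
    moreover have "u \<in> digit_sums R \<pi> R1 (n - 1)" by (rule subsetD[OF mono u(1)]) (use False in linarith)
    ultimately show ?thesis using assms(22) by simp
  qed
  have on_J: "root_of_unity h (sum \<mu> (s <+\<^bsub>R\<^esub> PIdl\<^bsub>R\<^esub> (\<pi> [^]\<^bsub>R\<^esub> (n - b))))"
    if "b < n" and s: "s \<in> I" for b s
  proof (cases "b = 0")
    case True
    then show ?thesis using assms(23) s by (simp add: pow_n zero_coset[OF subsetD[OF M.a_subset s]])
  next
    case False
    \<comment> \<open>Elements of \<open>I\<close> carry one factor \<pi>: only the cofactor of
      \<open>s\<close> is expanded, to \<open>j\<close> digits, and multiplying by \<pi> raises the
      modulus to \<open>\<pi> [^] (j + 1)\<close>.\<close>
    define j where "j = n - b - 1"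
    have j: "n - b = j + 1" "j + 2 \<le> n" "j \<le> n - 2" using False \<open>b < n\<close> by (auto simp: j_def)
    obtain c where c: "c \<in> carrier R" "s = c \<otimes>\<^bsub>R\<^esub> \<pi>" using s unfolding I cgenideal_def by blast
    obtain u where u: "u \<in> digit_sums R \<pi> R1 j" "c \<in> u <+\<^bsub>R\<^esub> PIdl\<^bsub>R\<^esub> (\<pi> [^]\<^bsub>R\<^esub> j)"
      by (rule digit_expansion[OF reps c(1)])
    have uc: "u \<in> carrier R" using u(1) digit_sums_closed[OF R1c] by blast
    obtain t where t: "t \<in> carrier R" "c = u \<oplus>\<^bsub>R\<^esub> t \<otimes>\<^bsub>R\<^esub> \<pi> [^]\<^bsub>R\<^esub> j"
      using u(2) unfolding a_l_coset_def' cgenideal_def by blast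
    let ?v = "\<pi> \<otimes>\<^bsub>R\<^esub> u"
    have v: "?v \<in> \<pi> <#\<^bsub>R\<^esub> digit_sums R \<pi> R1 j" using u(1) unfolding l_coset_def by blast
    have "s = ?v \<oplus>\<^bsub>R\<^esub> t \<otimes>\<^bsub>R\<^esub> \<pi> [^]\<^bsub>R\<^esub> (j + 1)"
      using t(1) uc unfolding c(2) t(2) by (simp add: l_distr m_assoc m_comm[of u])
    then have "s \<in> ?v <+\<^bsub>R\<^esub> PIdl\<^bsub>R\<^esub> (\<pi> [^]\<^bsub>R\<^esub> (j + 1))"
      using t(1) unfolding a_l_coset_def' cgenideal_def by blast
    from l_coset_eqI[OF _ _ this]
    have "s <+\<^bsub>R\<^esub> PIdl\<^bsub>R\<^esub> (\<pi> [^]\<^bsub>R\<^esub> (j + 1)) = ?v <+\<^bsub>R\<^esub> PIdl\<^bsub>R\<^esub> (\<pi> [^]\<^bsub>R\<^esub> (j + 1))"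
      using uc by (simp add: cgenideal_ideal)
    then have "sum \<mu> (s <+\<^bsub>R\<^esub> PIdl\<^bsub>R\<^esub> (\<pi> [^]\<^bsub>R\<^esub> (n - b))) = \<gamma> ?v"
      using \<gamma>[OF j(2) v] unfolding j(1) by (simp only:)
    moreover have "?v \<in> \<pi> <#\<^bsub>R\<^esub> digit_sums R \<pi> R1 (n - 2)"
      using subsetD[OF mono[OF j(3)] u(1)] unfolding l_coset_def by blast
    ultimately show ?thesis using assms(24) j(2) by simp
  qed
  have root: "root_of_unity h (D (x, y))" if xy: "x \<in> carrier R" "y \<in> carrier R" for x y
  proof (cases "(x, y) = (\<zero>\<^bsub>R\<^esub>, \<zero>\<^bsub>R\<^esub>)")
    case True
    have "{r \<in> carrier R. \<zero>\<^bsub>R\<^esub> \<otimes>\<^bsub>R\<^esub> r = \<zero>\<^bsub>R\<^esub>} = carrier R" "{s \<in> I. \<zero>\<^bsub>R\<^esub> \<otimes>\<^bsub>R\<^esub> s = \<zero>\<^bsub>R\<^esub>} = I"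
      using M.a_subset by auto
    then have "D (x, y) = \<eta>"
      using total True line_sum_eq[OF finite_carrier M.a_subset xy, of \<eta>r \<mu>] by (simp add: D)
    then show ?thesis using assms(20) by simp
  next
    case False
    from line_sum_eq_coset_sum[OF xy False, of \<eta>r \<mu>, folded I] show ?thesis
      using on_I on_J by (auto simp: D)
  qed
  let ?G = "add_square R"
  interpret G: comm_group ?G
  proof (rule group.group_comm_groupI)
    show "group ?G" by (intro DirProd_group a_group)
  qed (auto simp: DirProd_def a_comm)
  have carrier_G: "carrier ?G = carrier R \<times> carrier R" by (simp add: DirProd_def)
  have root_G: "root_of_unity h (D g)" if "g \<in> carrier ?G" for g
    using that root unfolding carrier_G by auto
  \<comment> \<open>Modulus one is the input of the Parseval argument.\<close>
  have norm_D: "norm (D k) = 1" if "k \<in> carrier R \<times> carrier R" for k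
    using power_eq_1_iff[of "D k" h] root_G[of k] that assms(5) by (simp add: root_of_unity_def carrier_G)
  obtain \<psi> where "generating_character R \<psi>" by (rule ex_generating_character)
  then interpret generating_character R \<psi> .
  have order_G: "order ?G = order R ^ 2"
    by (simp add: order_def carrier_G card_cartesian_product power2_eq_square)
  have ac: "(\<Sum>k\<in>carrier ?G. D (g \<otimes>\<^bsub>?G\<^esub> k) * cnj (D k)) = (if g = \<one>\<^bsub>?G\<^esub> then of_nat (order ?G) else 0)"
    if "g \<in> carrier ?G" for g
  proof -
    obtain x y where g: "g = (x, y)" "x \<in> carrier R" "y \<in> carrier R" using \<open>g \<in> _\<close> carrier_G by auto
    have "(\<Sum>k\<in>carrier ?G. D (g \<otimes>\<^bsub>?G\<^esub> k) * cnj (D k))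
      = (\<Sum>k\<in>carrier R \<times> carrier R. D (x \<oplus>\<^bsub>R\<^esub> fst k, y \<oplus>\<^bsub>R\<^esub> snd k) * cnj (D k))"
      by (intro sum.cong) (auto simp: g(1) DirProd_def)
    then show ?thesis
      using line_sum_autocorrelation[OF M.a_subset norm_D[unfolded D] g(2,3)]
      unfolding D order_G by (simp add: g(1) DirProd_def)
  qed
  have "D \<in> group_ring (int_adjoin \<zeta>) ?G"
    unfolding group_ring_def
  proof (intro CollectI conjI ballI allI impI)
    fix g assume "g \<in> carrier ?G"
    then show "D g \<in> int_adjoin \<zeta>"
      using int_adjoin_of_root_of_unity[OF assms(5,19)] root_G by blast
  next
    fix g assume "g \<notin> carrier ?G"
    then have "g \<notin> line_I R r" "g \<notin> line_J R r" if "r \<in> carrier R" for r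
      using that by (auto simp: carrier_G line_I_def line_J_def)
    moreover have "s \<in> carrier R" if "s \<in> I" for s using that M.a_subset by blast
    ultimately show "D g = 0" unfolding D line_sum_def by simp
  qed
  then show ?thesis
    using root_G G.gr_mult_star_eq[OF ac] G.BH_matrix_of_autocorrelation[OF root_G ac]
    by (intro conjI exI ballI)
qed

end
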